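(* On $S^3$ there exist non-Riemannian homogeneous Randers metrics $F$ such that $(S^3,F)$ is CW-homogeneous.
   Context: A Randers metric is a Finsler metric $F=\alpha+\beta$ with $\alpha$ a Riemannian metric and $\beta$ a 1-form of $\alpha$-length everywhere less than $1$; it is non-Riemannian if $\beta\neq0$. A Finsler metric is homogeneous if the identity component of its isometry group acts transitively. The (possibly non-symmetric) distance $d(x,y)$ is the infimum of $F$-lengths of piecewise smooth curves from $x$ to $y$. A Clifford-Wolf translation (CW-translation) of a Finsler manifold $(M,F)$ is an isometry $\rho$ of $(M,F)$ such that $x\mapsto d(x,\rho(x))$ is constant. $(M,F)$ is CW-homogeneous if for any $x_1,x_2\in M$ there is a CW-translation $\sigma$ with $\sigma(x_1)=x_2$. *)

theory Defs
  imports "HOL-Analysis.Analysis"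
begin

subsection \<open>Smooth maps between subsets of Euclidean spaces\<close>

text \<open>\<open>Ck_on k U f\<close>: on the open set \<open>U\<close>, all iterated directional derivatives of \<open>f\<close> of
  order at most \<open>k\<close> exist and are continuous; in finite dimension this is the class
  \<open>C\<^sup>k\<close>.\<close>

primrec Ck_on :: "nat \<Rightarrow> 'a::euclidean_space set \<Rightarrow> ('a \<Rightarrow> 'b::euclidean_space) \<Rightarrow> bool" where
  "Ck_on 0 U f \<longleftrightarrow> continuous_on U f"
| "Ck_on (Suc k) U f \<longleftrightarrow>
     (\<forall>x\<in>U. f differentiable at x) \<and> (\<forall>v. Ck_on k U (\<lambda>x. frechet_derivative f (at x) v))"

text \<open>On an arbitrary subset \<open>S\<close>, smooth means locally the restriction of a
  \<open>C\<^sup>\<infinity>\<close> map defined on an open set of the ambient space. On an embedded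
  submanifold this is the intrinsic notion of smoothness; on a compact interval it is smoothness
  up to and including the end points. Values outside \<open>S\<close> are irrelevant.\<close>

definition smooth_on :: "'a::euclidean_space set \<Rightarrow> ('a \<Rightarrow> 'b::euclidean_space) \<Rightarrow> bool" where
  "smooth_on S f \<longleftrightarrow>
     (\<forall>x\<in>S. \<exists>U h. open U \<and> x \<in> U \<and> (\<forall>k. Ck_on k U h) \<and> (\<forall>y\<in>S \<inter> U. f y = h y))"


subsection \<open>The three-sphere and tensor fields on it\<close>

abbreviation S3 :: "(real^4) set" where
  "S3 \<equiv> sphere 0 1"

text \<open>The tangent space of the unit sphere at \<open>x\<close>, as a subspace of the ambient space. Below,
  a form or a Finsler metric takes a base point and ambient vectors as arguments, but only its
  values at points of \<open>S3\<close> and on tangent vectors matter.\<close>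

definition tangent :: "real^4 \<Rightarrow> (real^4) set" where
  "tangent x = {v. x \<bullet> v = 0}"

definition smooth_vector_field :: "(real^4 \<Rightarrow> real^4) \<Rightarrow> bool" where
  "smooth_vector_field X \<longleftrightarrow> smooth_on S3 X \<and> (\<forall>x\<in>S3. X x \<in> tangent x)"

definition riemannian_metric :: "(real^4 \<Rightarrow> real^4 \<Rightarrow> real^4 \<Rightarrow> real) \<Rightarrow> bool" where
  "riemannian_metric g \<longleftrightarrow>
     (\<forall>x\<in>S3. \<forall>u\<in>tangent x. \<forall>v\<in>tangent x.
        g x u v = g x v u \<and>
        (\<forall>w\<in>tangent x. \<forall>a b. g x (a *\<^sub>R u + b *\<^sub>R v) w = a * g x u w + b * g x v w)) \<and>
     (\<forall>x\<in>S3. \<forall>v\<in>tangent x. v \<noteq> 0 \<longrightarrow> g x v v > 0) \<and>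
     (\<forall>X Y. smooth_vector_field X \<and> smooth_vector_field Y \<longrightarrow>
        smooth_on S3 (\<lambda>x. g x (X x) (Y x)))"

definition one_form :: "(real^4 \<Rightarrow> real^4 \<Rightarrow> real) \<Rightarrow> bool" where
  "one_form \<beta> \<longleftrightarrow>
     (\<forall>x\<in>S3. \<forall>u\<in>tangent x. \<forall>v\<in>tangent x. \<forall>a b.
        \<beta> x (a *\<^sub>R u + b *\<^sub>R v) = a * \<beta> x u + b * \<beta> x v) \<and>
     (\<forall>X. smooth_vector_field X \<longrightarrow> smooth_on S3 (\<lambda>x. \<beta> x (X x)))"

definition one_form_length ::
    "(real^4 \<Rightarrow> real^4 \<Rightarrow> real^4 \<Rightarrow> real) \<Rightarrow> (real^4 \<Rightarrow> real^4 \<Rightarrow> real) \<Rightarrow> real^4 \<Rightarrow> real" where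
  "one_form_length g \<beta> x = (SUP v\<in>{v \<in> tangent x. g x v v = 1}. \<bar>\<beta> x v\<bar>)"

definition nonzero_form :: "(real^4 \<Rightarrow> real^4 \<Rightarrow> real) \<Rightarrow> bool" where
  "nonzero_form \<beta> \<longleftrightarrow> (\<exists>x\<in>S3. \<exists>v\<in>tangent x. \<beta> x v \<noteq> 0)"


subsection \<open>Finsler and Randers metrics\<close>

text \<open>The fundamental tensor
  \<open>g\<^sub>y(u,v) = 1/2 \<partial>\<^sup>2/\<partial>s\<partial>t F\<^sup>2(x, y + s u + t v)\<close> at \<open>s = t = 0\<close>,
  i.e. the Hessian of \<open>F\<^sup>2/2\<close> along the fibre.\<close>

definition fundamental_tensor ::
    "(real^4 \<Rightarrow> real^4 \<Rightarrow> real) \<Rightarrow> real^4 \<Rightarrow> real^4 \<Rightarrow> real^4 \<Rightarrow> real^4 \<Rightarrow> real" where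
  "fundamental_tensor F x y u v =
     deriv (\<lambda>s. deriv (\<lambda>t. (F x (y + s *\<^sub>R u + t *\<^sub>R v))\<^sup>2 / 2) 0) 0"

definition finsler_metric :: "(real^4 \<Rightarrow> real^4 \<Rightarrow> real) \<Rightarrow> bool" where
  "finsler_metric F \<longleftrightarrow>
     smooth_on {(x, v). x \<in> S3 \<and> v \<in> tangent x \<and> v \<noteq> 0} (\<lambda>(x, v). F x v) \<and>
     (\<forall>x\<in>S3. \<forall>v\<in>tangent x. v \<noteq> 0 \<longrightarrow> F x v > 0) \<and>
     (\<forall>x\<in>S3. \<forall>v\<in>tangent x. \<forall>c\<ge>0. F x (c *\<^sub>R v) = c * F x v) \<and>
     (\<forall>x\<in>S3. \<forall>y\<in>tangent x. \<forall>u\<in>tangent x. y \<noteq> 0 \<and> u \<noteq> 0 \<longrightarrow> fundamental_tensor F x y u u > 0)"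

definition randers_metric ::
    "(real^4 \<Rightarrow> real^4 \<Rightarrow> real) \<Rightarrow> (real^4 \<Rightarrow> real^4 \<Rightarrow> real^4 \<Rightarrow> real) \<Rightarrow>
     (real^4 \<Rightarrow> real^4 \<Rightarrow> real) \<Rightarrow> bool" where
  "randers_metric F g \<beta> \<longleftrightarrow>
     finsler_metric F \<and> riemannian_metric g \<and> one_form \<beta> \<and>
     (\<forall>x\<in>S3. one_form_length g \<beta> x < 1) \<and>
     (\<forall>x\<in>S3. \<forall>v\<in>tangent x. F x v = sqrt (g x v v) + \<beta> x v)"

definition non_riemannian_randers :: "(real^4 \<Rightarrow> real^4 \<Rightarrow> real) \<Rightarrow> bool" where
  "non_riemannian_randers F \<longleftrightarrow> (\<exists>g \<beta>. randers_metric F g \<beta> \<and> nonzero_form \<beta>)"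


subsection \<open>Distance\<close>

text \<open>\<open>P\<close> is a set of break points: between consecutive ones the curve is smooth up to the
  end points.\<close>

definition piecewise_smooth :: "(real \<Rightarrow> real^4) \<Rightarrow> bool" where
  "piecewise_smooth c \<longleftrightarrow>
     continuous_on {0..1} c \<and>
     (\<exists>P. finite P \<and>
        (\<forall>s t. 0 \<le> s \<and> s < t \<and> t \<le> 1 \<and> {s<..<t} \<inter> P = {} \<longrightarrow> smooth_on {s..t} c))"

text \<open>The velocity at the finitely many break points does not affect the integral.\<close>

definition finsler_length :: "(real^4 \<Rightarrow> real^4 \<Rightarrow> real) \<Rightarrow> (real \<Rightarrow> real^4) \<Rightarrow> real" where
  "finsler_length F c = integral {0..1} (\<lambda>t. F (c t) (vector_derivative c (at t within {0..1})))"

definition finsler_dist :: "(real^4 \<Rightarrow> real^4 \<Rightarrow> real) \<Rightarrow> real^4 \<Rightarrow> real^4 \<Rightarrow> real" where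
  "finsler_dist F x y =
     Inf {finsler_length F c | c.
            piecewise_smooth c \<and> path_image c \<subseteq> S3 \<and> pathstart c = x \<and> pathfinish c = y}"


subsection \<open>Isometries and homogeneity\<close>

text \<open>The differential of a smooth self-map of \<open>S3\<close>. A Frechet derivative within \<open>S3\<close> is
  determined by the map on tangent vectors (though not on the normal direction), so the choice
  made by \<open>frechet_derivative\<close> is immaterial there.\<close>

definition differential :: "(real^4 \<Rightarrow> real^4) \<Rightarrow> real^4 \<Rightarrow> real^4 \<Rightarrow> real^4" where
  "differential \<phi> x = frechet_derivative \<phi> (at x within S3)"

text \<open>Isometries are the diffeomorphisms that preserve \<open>F\<close>. They are taken extensional, so that
  two isometries are equal iff they agree on \<open>S3\<close>.\<close>

definition isometries :: "(real^4 \<Rightarrow> real^4 \<Rightarrow> real) \<Rightarrow> (real^4 \<Rightarrow> real^4) set" where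
  "isometries F =
     {\<phi> \<in> extensional S3. bij_betw \<phi> S3 S3 \<and> smooth_on S3 \<phi> \<and> smooth_on S3 (inv_into S3 \<phi>) \<and>
        (\<forall>x\<in>S3. \<forall>v\<in>tangent x. F (\<phi> x) (differential \<phi> x v) = F x v)}"

text \<open>The isometry group carries the compact-open topology.\<close>

definition isometry_topology :: "(real^4 \<Rightarrow> real^4 \<Rightarrow> real) \<Rightarrow> (real^4 \<Rightarrow> real^4) topology" where
  "isometry_topology F =
     subtopology
       (topology_generated_by {{\<phi>. \<phi> ` K \<subseteq> U} | K U. compact K \<and> K \<subseteq> S3 \<and> open U})
       (isometries F)"

definition identity_component :: "(real^4 \<Rightarrow> real^4 \<Rightarrow> real) \<Rightarrow> (real^4 \<Rightarrow> real^4) set" where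
  "identity_component F =
     connected_component_of_set (isometry_topology F) (restrict id S3)"

definition homogeneous :: "(real^4 \<Rightarrow> real^4 \<Rightarrow> real) \<Rightarrow> bool" where
  "homogeneous F \<longleftrightarrow> (\<forall>x\<in>S3. \<forall>y\<in>S3. \<exists>\<phi>\<in>identity_component F. \<phi> x = y)"

definition CW_translation :: "(real^4 \<Rightarrow> real^4 \<Rightarrow> real) \<Rightarrow> (real^4 \<Rightarrow> real^4) \<Rightarrow> bool" where
  "CW_translation F \<rho> \<longleftrightarrow>
     \<rho> \<in> isometries F \<and> (\<lambda>x. finsler_dist F x (\<rho> x)) constant_on S3"

definition CW_homogeneous :: "(real^4 \<Rightarrow> real^4 \<Rightarrow> real) \<Rightarrow> bool" where
  "CW_homogeneous F \<longleftrightarrow>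
     (\<forall>x\<^sub>1\<in>S3. \<forall>x\<^sub>2\<in>S3. \<exists>\<sigma>. CW_translation F \<sigma> \<and> \<sigma> x\<^sub>1 = x\<^sub>2)"

end

theory Submission
  imports Defs
begin

text \<open>The metric solves Zermelo's navigation problem on the round sphere for the wind \<open>W\<close>, half of
  the unit Hopf field \<open>x \<mapsto> x i\<close>: up to the factor \<open>3/2\<close>, its unit spheres are the round unit
  spheres translated by \<open>W\<close>. The flow \<open>R\<^sub>s\<close> of the Hopf field consists of isometries and
  commutes with left quaternion multiplications, so these act isometrically and transitively.

  Pulling a curve from \<open>x\<close> to \<open>y\<close> back along the wind, by \<open>R\<close> at minus half the elapsed time,
  turns Randers length into round length. Hence if the round angle between \<open>R\<^bsub>t/2\<^esub> x\<close> and \<open>y\<close> is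
  \<open>t\<close>, then \<open>y\<close> has distance \<open>3/2 t\<close> from \<open>x\<close>: a great circle carried by the wind attains this
  value, and nothing faster exists because \<open>W\<close> is slower than the round speed \<open>1\<close>. For a unit
  quaternion \<open>a\<close> with real part \<open>cos t\<close> the isometry \<open>x \<mapsto> a R\<^bsub>t/2\<^esub> x\<close> moves every point by this
  same amount. Given \<open>x\<^sub>1\<close> and \<open>x\<^sub>2\<close>, the intermediate value theorem provides
  \<open>t \<in> [0, \<pi>]\<close> at which the angle between \<open>R\<^bsub>t/2\<^esub> x\<^sub>1\<close> and \<open>x\<^sub>2\<close> equals \<open>t\<close>.\<close>

subsection \<open>Calculus of smooth maps\<close>

lemma Ck_on_mono: "Ck_on k U f \<Longrightarrow> V \<subseteq> U \<Longrightarrow> Ck_on k V f"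
  by (induction k arbitrary: f) (auto intro: continuous_on_subset)

lemma Ck_on_cong:
  "open U \<Longrightarrow> (\<And>x. x \<in> U \<Longrightarrow> f x = g x) \<Longrightarrow> Ck_on k U f \<Longrightarrow> Ck_on k U g"
proof (induction k arbitrary: f g)
  case 0
  then show ?case using continuous_on_cong[of U U f g] by simp
next
  case (Suc k)
  have d: "(g has_derivative frechet_derivative f (at x)) (at x)" if x: "x \<in> U" for x
  proof -
    have "(f has_derivative frechet_derivative f (at x)) (at x)"
      using Suc.prems(3) x by (simp add: frechet_derivative_works)
    then show ?thesis
      by (rule has_derivative_transform_within_open[OF _ Suc.prems(1) x]) (use Suc.prems in auto)
  qed
  have e: "frechet_derivative f (at x) v = frechet_derivative g (at x) v" if "x \<in> U" for x v
    using frechet_derivative_at[OF d[OF that]] by simp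
  have "Ck_on k U (\<lambda>x. frechet_derivative g (at x) v)" for v
    using Suc.IH[OF Suc.prems(1), of "\<lambda>x. frechet_derivative f (at x) v"] e Suc.prems(3) by auto
  then show ?case using d by (auto simp: differentiable_def)
qed

text \<open>Derivatives at a point are unique, so a derivative in closed form can stand in for
  \<open>frechet_derivative\<close>; the inductions below rest on this.\<close>

lemma Ck_on_SucI:
  assumes "open U" "\<And>x. x \<in> U \<Longrightarrow> (f has_derivative f' x) (at x)"
    and "\<And>v. Ck_on k U (\<lambda>x. f' x v)"
  shows "Ck_on (Suc k) U f"
  using assms(2) frechet_derivative_at[OF assms(2)]
  by (auto simp: differentiable_def intro!: Ck_on_cong[OF assms(1) _ assms(3)])

lemma Ck_on_SucD1:
  "Ck_on (Suc k) U f \<Longrightarrow> x \<in> U \<Longrightarrow> (f has_derivative frechet_derivative f (at x)) (at x)"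
  by (simp add: frechet_derivative_works)

lemma Ck_on_SucD2: "Ck_on (Suc k) U f \<Longrightarrow> Ck_on k U f"
  by (induction k arbitrary: f)
    (auto intro: differentiable_imp_continuous_on simp: differentiable_on_def differentiable_at_withinI)

lemma Ck_on_const: "open U \<Longrightarrow> Ck_on k U (\<lambda>x. c)"
proof (induction k arbitrary: c)
  case (Suc k)
  then show ?case by (intro Ck_on_SucI[where f'="\<lambda>x v. 0"]) auto
qed simp

lemma Ck_on_bounded_linear: "open U \<Longrightarrow> bounded_linear f \<Longrightarrow> Ck_on k U f"
proof (cases k)
  case (Suc k)
  assume "open U" "bounded_linear f"
  then have "Ck_on (Suc k) U f"
    by (intro Ck_on_SucI[where f'="\<lambda>x. f"] bounded_linear_imp_has_derivative Ck_on_const)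
  then show ?thesis using Suc by simp
qed (auto intro: linear_continuous_on)

lemma Ck_on_add:
  "open U \<Longrightarrow> Ck_on k U f \<Longrightarrow> Ck_on k U g \<Longrightarrow> Ck_on k U (\<lambda>x. f x + g x)"
proof (induction k arbitrary: f g)
  case (Suc k)
  show ?case
    by (rule Ck_on_SucI[OF Suc.prems(1) has_derivative_add[OF Ck_on_SucD1[OF Suc.prems(2)]
          Ck_on_SucD1[OF Suc.prems(3)]]]) (use Suc in auto)
qed (auto intro: continuous_intros)

text \<open>One Leibniz rule serves multiplication, inner product and scaling. In each term one
  factor is differentiated and the other is weakened from order \<open>Suc k\<close> to
  \<open>k\<close>.\<close>

lemma Ck_on_bilinear:
  fixes prod :: "'b::euclidean_space \<Rightarrow> 'c::euclidean_space \<Rightarrow> 'd::euclidean_space"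
  assumes prod: "bounded_bilinear prod"
  shows "open U \<Longrightarrow> Ck_on k U f \<Longrightarrow> Ck_on k U g \<Longrightarrow> Ck_on k U (\<lambda>x. prod (f x) (g x))"
proof (induction k arbitrary: f g)
  case 0
  then show ?case by (auto intro: bounded_bilinear.continuous_on[OF prod])
next
  case (Suc k)
  have "Ck_on k U (\<lambda>x. prod (f x) (frechet_derivative g (at x) v))"
    "Ck_on k U (\<lambda>x. prod (frechet_derivative f (at x) v) (g x))" for v
    using Suc.prems by (auto intro!: Suc.IH Ck_on_SucD2[OF Suc.prems(2)] Ck_on_SucD2[OF Suc.prems(3)])
  then show ?case
    by (intro Ck_on_SucI[OF Suc.prems(1) bounded_bilinear.FDERIV[OF prod Ck_on_SucD1[OF Suc.prems(2)]
          Ck_on_SucD1[OF Suc.prems(3)]]] Ck_on_add[OF Suc.prems(1)]) auto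
qed

lemma Ck_on_linear_compose:
  fixes f :: "'b::euclidean_space \<Rightarrow> 'c::euclidean_space"
  assumes f: "bounded_linear f"
  shows "open U \<Longrightarrow> Ck_on k U g \<Longrightarrow> Ck_on k U (\<lambda>x. f (g x))"
proof (induction k arbitrary: g)
  case 0
  then show ?case by (auto intro: bounded_linear.continuous_on[OF f])
next
  case (Suc k)
  then show ?case
    by (intro Ck_on_SucI[OF Suc.prems(1) bounded_linear.has_derivative[OF f Ck_on_SucD1[OF Suc.prems(2)]]]) auto
qed

lemmas Ck_on_mult = Ck_on_bilinear[OF bounded_bilinear_mult]
lemmas Ck_on_inner = Ck_on_bilinear[OF bounded_bilinear_inner]
lemmas Ck_on_scaleR = Ck_on_bilinear[OF bounded_bilinear_scaleR]
lemmas Ck_on_minus = Ck_on_linear_compose[OF bounded_linear_minus[OF bounded_linear_ident]]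

text \<open>Differentiation lowers the exponent by 1, so the induction needs arbitrary
  \<open>r\<close>; a statement about square roots alone would not reproduce itself.\<close>

lemma Ck_on_powr:
  fixes f :: "'a::euclidean_space \<Rightarrow> real"
  assumes "open U" "\<And>x. x \<in> U \<Longrightarrow> f x > 0" "Ck_on k U f"
  shows "Ck_on k U (\<lambda>x. f x powr r)"
  using assms(3)
proof (induction k arbitrary: r)
  case 0
  have "continuous_on U f" "\<forall>x\<in>U. f x \<noteq> 0"
    using 0 assms(2) by auto (metis less_irrefl)
  then show ?case by (simp add: continuous_on_powr)
next
  case (Suc k)
  have d: "((\<lambda>x. f x powr r) has_derivative
      (\<lambda>v. r * (f x powr (r - 1) * frechet_derivative f (at x) v))) (at x)" if x: "x \<in> U" for x
    using DERIV_compose_FDERIV[where f="\<lambda>z. z powr r" and g=f,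
        OF has_real_derivative_powr[OF assms(2)[OF x]] Ck_on_SucD1[OF Suc.prems x]]
    by (simp add: ac_simps)
  have "Ck_on k U (\<lambda>x. r * (f x powr (r - 1) * frechet_derivative f (at x) v))" for v
    using Suc.prems by (intro Ck_on_mult Ck_on_const assms(1) Suc.IH Ck_on_SucD2[OF Suc.prems]) simp
  then show ?case
    by (intro Ck_on_SucI[where f'="\<lambda>x v. r * (f x powr (r - 1) * frechet_derivative f (at x) v)"]
        assms(1) d)
qed

text \<open>The derivative of each function involves the other, hence the simultaneous
  induction.\<close>

lemma Ck_on_cos_sin:
  fixes f :: "'a::euclidean_space \<Rightarrow> real"
  assumes "open U" "Ck_on k U f"
  shows "Ck_on k U (\<lambda>x. cos (f x)) \<and> Ck_on k U (\<lambda>x. sin (f x))"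
  using assms(2)
proof (induction k)
  case 0
  then show ?case by (auto intro!: continuous_intros)
next
  case (Suc k)
  have k: "Ck_on k U (\<lambda>x. cos (f x))" "Ck_on k U (\<lambda>x. sin (f x))"
    using Suc.IH[OF Ck_on_SucD2[OF Suc.prems]] by auto
  have f: "Ck_on k U (\<lambda>x. frechet_derivative f (at x) v)" for v
    using Suc.prems by simp
  have c: "((\<lambda>x. cos (f x)) has_derivative (\<lambda>v. - (sin (f x) * frechet_derivative f (at x) v))) (at x)"
    and s: "((\<lambda>x. sin (f x)) has_derivative (\<lambda>v. cos (f x) * frechet_derivative f (at x) v)) (at x)"
    if x: "x \<in> U" for x
    using DERIV_compose_FDERIV[where f=cos and g=f, OF DERIV_cos Ck_on_SucD1[OF Suc.prems x]]
      DERIV_compose_FDERIV[where f=sin and g=f, OF DERIV_sin Ck_on_SucD1[OF Suc.prems x]]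
    by (simp_all only: mult.commute[of "frechet_derivative f (at x) _"] mult_minus_left)
  have "Ck_on k U (\<lambda>x. - (sin (f x) * frechet_derivative f (at x) v))"
    "Ck_on k U (\<lambda>x. cos (f x) * frechet_derivative f (at x) v)" for v
    by (intro Ck_on_minus Ck_on_mult assms(1) k f)+
  then show ?case
    by (intro conjI assms(1) c s
        Ck_on_SucI[where f'="\<lambda>x v. - (sin (f x) * frechet_derivative f (at x) v)" and f="\<lambda>x. cos (f x)"]
        Ck_on_SucI[where f'="\<lambda>x v. cos (f x) * frechet_derivative f (at x) v" and f="\<lambda>x. sin (f x)"])
qed

section \<open>Smoothness on arbitrary subsets\<close>

lemma smooth_on_Ck:
  "open U \<Longrightarrow> S \<subseteq> U \<Longrightarrow> (\<And>k. Ck_on k U f) \<Longrightarrow> smooth_on S f"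
  unfolding smooth_on_def by blast

lemma smooth_onE:
  assumes "smooth_on S f" "x \<in> S"
  obtains U h where "open U" "x \<in> U" "\<And>k. Ck_on k U h" "\<And>y. y \<in> S \<inter> U \<Longrightarrow> f y = h y"
proof -
  obtain U h where "open U \<and> x \<in> U \<and> (\<forall>k. Ck_on k U h) \<and> (\<forall>y\<in>S \<inter> U. f y = h y)"
    using bspec[OF assms(1)[unfolded smooth_on_def] assms(2)] by (elim exE) (rule that)
  then show ?thesis by (intro that[of U h]; simp)
qed

lemma smooth_on_cong:
  "(\<And>x. x \<in> S \<Longrightarrow> f x = g x) \<Longrightarrow> smooth_on S f \<Longrightarrow> smooth_on S g"
  unfolding smooth_on_def by (metis IntD1)

lemma smooth_on_bounded_linear: "bounded_linear f \<Longrightarrow> smooth_on S f"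
  by (rule smooth_on_Ck[of UNIV]) (auto intro: Ck_on_bounded_linear)

text \<open>Local extensions of \<open>f\<close> and \<open>g\<close> combine on the intersection of
  their neighbourhoods, so closure of \<open>Ck_on\<close> under \<open>op\<close> carries
  over.\<close>

lemma smooth_on_binop:
  fixes S :: "'a::euclidean_space set"
  assumes op: "\<And>k (U::'a set) f g. open U \<Longrightarrow> Ck_on k U f \<Longrightarrow> Ck_on k U g \<Longrightarrow> Ck_on k U (\<lambda>x. op (f x) (g x))"
    and "smooth_on S f" "smooth_on S g"
  shows "smooth_on S (\<lambda>x. op (f x) (g x))"
  unfolding smooth_on_def
proof
  fix x assume x: "x \<in> S"
  obtain U h where U: "open U" "x \<in> U" "\<And>k. Ck_on k U h" "\<And>y. y \<in> S \<inter> U \<Longrightarrow> f y = h y"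
    by (rule smooth_onE[OF assms(2) x]) (rule that)
  obtain V j where V: "open V" "x \<in> V" "\<And>k. Ck_on k V j" "\<And>y. y \<in> S \<inter> V \<Longrightarrow> g y = j y"
    by (rule smooth_onE[OF assms(3) x]) (rule that)
  have "Ck_on k (U \<inter> V) (\<lambda>x. op (h x) (j x))" for k
    by (intro op open_Int U(1) V(1) Ck_on_mono[OF U(3)] Ck_on_mono[OF V(3)] Int_lower1 Int_lower2)
  then show "\<exists>W h. open W \<and> x \<in> W \<and> (\<forall>k. Ck_on k W h) \<and> (\<forall>y\<in>S \<inter> W. op (f y) (g y) = h y)"
    using U(1,2,4) V(1,2,4) by (intro exI[of _ "U \<inter> V"] exI[of _ "\<lambda>x. op (h x) (j x)"]) auto
qed

lemmas smooth_on_add = smooth_on_binop[where op="(+)", OF Ck_on_add]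
lemmas smooth_on_mult = smooth_on_binop[where op="(*)", OF Ck_on_mult]
lemmas smooth_on_inner = smooth_on_binop[where op="(\<bullet>)", OF Ck_on_inner]

lemma smooth_on_linear_compose:
  assumes "bounded_linear f"
  shows "smooth_on S g \<Longrightarrow> smooth_on S (\<lambda>x. f (g x))"
  by (rule smooth_on_binop[where op="\<lambda>a b. f a" and f=g and g=g]) (rule Ck_on_linear_compose[OF assms])

text \<open>Near each point of the interval, end points included, \<open>c\<close> agrees with a
  smooth map \<open>h\<close> on an open set; the derivative within the interval is therefore the
  continuous derivative of \<open>h\<close>.\<close>

lemma smooth_curve_derivative:
  fixes c :: "real \<Rightarrow> 'a::euclidean_space"
  assumes "smooth_on {a..b} c" "a < b"
  shows "\<And>t. t \<in> {a..b} \<Longrightarrow>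
      (c has_vector_derivative vector_derivative c (at t within {a..b})) (at t within {a..b})"
    and "continuous_on {a..b} (\<lambda>t. vector_derivative c (at t within {a..b}))"
proof -
  let ?d = "\<lambda>t. vector_derivative c (at t within {a..b})"
  have *: "(c has_vector_derivative ?d t) (at t within {a..b}) \<and> continuous (at t within {a..b}) ?d"
    if t: "t \<in> {a..b}" for t
  proof -
    obtain U h where U: "open U" "t \<in> U" "\<And>k. Ck_on k U h" "\<And>y. y \<in> {a..b} \<inter> U \<Longrightarrow> c y = h y"
      by (rule smooth_onE[OF assms(1) t]) (rule that)
    define h' where "h' y = frechet_derivative h (at y) 1" for y
    have h: "(c has_vector_derivative h' y) (at y within {a..b})" if y: "y \<in> {a..b} \<inter> U" for y
    proof -
      have "(h has_derivative frechet_derivative h (at y)) (at y)"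
        using Ck_on_SucD1[OF U(3)] y by blast
      moreover from this have "frechet_derivative h (at y) x = x *\<^sub>R h' y" for x
        using linear_scale[OF has_derivative_linear, of h "frechet_derivative h (at y)" "at y" x 1]
        by (simp add: h'_def)
      then have "frechet_derivative h (at y) = (\<lambda>x. x *\<^sub>R h' y)" ..
      ultimately have hd: "(h has_vector_derivative h' y) (at y within {a..b})"
        by (simp add: has_vector_derivative_def has_derivative_at_withinI)
      then have "eventually (\<lambda>z. h z = c z) (at y within {a..b})"
        using y U(1,4) by (auto simp: eventually_at_topological)
      with hd have "(c has_derivative (\<lambda>x. x *\<^sub>R h' y)) (at y within {a..b})"
        unfolding has_vector_derivative_def
        by (rule has_derivative_transform_eventually) (use y U(4) in auto)
      then show ?thesis
        by (simp add: has_vector_derivative_def)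
    qed
    have e: "?d y = h' y" if "y \<in> {a..b} \<inter> U" for y
      using vector_derivative_within_closed_interval[OF assms(2) _ h] that by auto
    have "continuous_on U h'"
      using U(3)[of "Suc 0"] unfolding h'_def by simp
    then have "continuous_on ({a..b} \<inter> U) ?d"
      using e continuous_on_subset[of U h' "{a..b} \<inter> U"]
        continuous_on_cong[of "{a..b} \<inter> U" "{a..b} \<inter> U" ?d h'] by simp
    then have "continuous (at t within {a..b} \<inter> U) ?d"
      using t U(2) by (simp add: continuous_on_eq_continuous_within)
    then have "continuous (at t within {a..b}) ?d"
      using at_within_nhd[OF U(2,1), of "{a..b}" "{a..b} \<inter> U"] by (simp add: continuous_within Int_assoc)
    then show ?thesis using h[of t] e[of t] t U(2) by simp
  qed
  show "\<And>t. t \<in> {a..b} \<Longrightarrow>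
      (c has_vector_derivative vector_derivative c (at t within {a..b})) (at t within {a..b})"
    and "continuous_on {a..b} (\<lambda>t. vector_derivative c (at t within {a..b}))"
    using * by (auto simp: continuous_on_eq_continuous_within)
qed

subsection \<open>Quaternions and the Hopf rotation\<close>

lemma vec4_eq_iff:
  fixes x y :: "real^4"
  shows "x = y \<longleftrightarrow> x$1 = y$1 \<and> x$2 = y$2 \<and> x$3 = y$3 \<and> x$4 = y$4"
  by (simp add: vec_eq_iff forall_4)

lemma inner_vec4:
  fixes x y :: "real^4"
  shows "x \<bullet> y = x$1 * y$1 + x$2 * y$2 + x$3 * y$3 + x$4 * y$4"
  by (simp add: inner_vec_def sum_4)

text \<open>Right multiplication by the quaternion \<open>i\<close>, with \<open>(x$1, x$2, x$3, x$4)\<close> standing for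
  \<open>x$1 + x$2 i + x$3 j + x$4 k\<close>.\<close>

definition hopf :: "real^4 \<Rightarrow> real^4" where
  "hopf x = (\<chi> i. if i = 1 then - x$2 else if i = 2 then x$1 else if i = 3 then x$4 else - x$3)"

lemma hopf_nth [simp]:
  "hopf x $ 1 = - x$2" "hopf x $ 2 = x$1" "hopf x $ 3 = x$4" "hopf x $ 4 = - x$3"
  by (simp_all add: hopf_def)

definition qmul :: "real^4 \<Rightarrow> real^4 \<Rightarrow> real^4" where
  "qmul a b = (\<chi> i.
     if i = 1 then a$1 * b$1 - a$2 * b$2 - a$3 * b$3 - a$4 * b$4
     else if i = 2 then a$1 * b$2 + a$2 * b$1 + a$3 * b$4 - a$4 * b$3
     else if i = 3 then a$1 * b$3 - a$2 * b$4 + a$3 * b$1 + a$4 * b$2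
     else a$1 * b$4 + a$2 * b$3 - a$3 * b$2 + a$4 * b$1)"

lemma qmul_nth [simp]:
  "qmul a b $ 1 = a$1 * b$1 - a$2 * b$2 - a$3 * b$3 - a$4 * b$4"
  "qmul a b $ 2 = a$1 * b$2 + a$2 * b$1 + a$3 * b$4 - a$4 * b$3"
  "qmul a b $ 3 = a$1 * b$3 - a$2 * b$4 + a$3 * b$1 + a$4 * b$2"
  "qmul a b $ 4 = a$1 * b$4 + a$2 * b$3 - a$3 * b$2 + a$4 * b$1"
  by (simp_all add: qmul_def)

definition qcnj :: "real^4 \<Rightarrow> real^4" where
  "qcnj x = (\<chi> i. if i = 1 then x$1 else - x$i)"

lemma qcnj_nth [simp]:
  "qcnj x $ 1 = x$1" "qcnj x $ 2 = - x$2" "qcnj x $ 3 = - x$3" "qcnj x $ 4 = - x$4"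
  by (simp_all add: qcnj_def)

lemma linear_hopf: "linear hopf"
  by (rule linearI) (simp_all add: vec4_eq_iff)

lemma bounded_linear_hopf: "bounded_linear hopf"
  using linear_hopf by (rule linear_conv_bounded_linear[THEN iffD1])

lemmas hopf_scaleR = linear_scale[OF linear_hopf]
lemmas hopf_add = linear_add[OF linear_hopf]

lemma hopf_hopf [simp]: "hopf (hopf x) = - x"
  by (simp add: vec4_eq_iff)

lemma hopf_inner [simp]: "hopf x \<bullet> hopf y = x \<bullet> y"
  by (simp add: inner_vec4)

lemma hopf_inner_self [simp]: "x \<bullet> hopf x = 0" "hopf x \<bullet> x = 0"
  by (simp_all add: inner_vec4)

lemma hopf_skew: "hopf x \<bullet> y = - (x \<bullet> hopf y)"
  by (simp add: inner_vec4)

lemma norm_hopf [simp]: "norm (hopf x) = norm x"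
  by (simp add: norm_eq_sqrt_inner)

lemma bilinear_qmul: "bounded_bilinear qmul"
  unfolding bilinear_conv_bounded_bilinear[symmetric] bilinear_def
  by (auto intro!: linearI simp: vec4_eq_iff algebra_simps)

text \<open>Associativity of quaternions: a left multiplication commutes with the right
  multiplication by i.\<close>

lemma qmul_hopf: "qmul a (hopf x) = hopf (qmul a x)"
  by (simp add: vec4_eq_iff algebra_simps)

lemma qmul_inner: "qmul a x \<bullet> qmul a y = (a \<bullet> a) * (x \<bullet> y)"
  by (simp add: inner_vec4 algebra_simps)

lemma norm_qmul: "norm (qmul a x) = norm a * norm x"
  by (simp add: norm_eq_sqrt_inner qmul_inner real_sqrt_mult)

text \<open>On the unit sphere the right-hand side does not depend on \<open>x\<close>: left
  multiplication by a unit quaternion moves all points through the same angle.\<close>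

lemma inner_qmul_self: "x \<bullet> qmul a x = a$1 * (x \<bullet> x)"
  by (simp add: inner_vec4 algebra_simps)

text \<open>The product of a quaternion with its conjugate is its squared norm. This gives the left
  multiplication that takes a unit vector \<open>x\<close> to \<open>y\<close>.\<close>

lemma qmul_qcnj: "qmul (qmul y (qcnj x)) x = (x \<bullet> x) *\<^sub>R y"
  by (simp add: inner_vec4 vec4_eq_iff algebra_simps)

lemma norm_qcnj [simp]: "norm (qcnj x) = norm x"
  by (simp add: norm_eq_sqrt_inner inner_vec4)

text \<open>Right multiplication by the unit quaternion \<open>cos t + i sin t\<close>, the flow of
  the Hopf field.\<close>

definition rot :: "real \<Rightarrow> real^4 \<Rightarrow> real^4" where
  "rot t x = cos t *\<^sub>R x + sin t *\<^sub>R hopf x"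

lemma rot_inner [simp]: "rot t x \<bullet> rot t y = x \<bullet> y"
proof -
  have "rot t x \<bullet> rot t y = cos t * cos t * (x \<bullet> y) + sin t * sin t * (x \<bullet> y)"
    by (simp add: rot_def inner_simps hopf_skew algebra_simps)
  also have "\<dots> = ((cos t)\<^sup>2 + (sin t)\<^sup>2) * (x \<bullet> y)"
    by (simp only: power2_eq_square distrib_right)
  finally show ?thesis by simp
qed

lemma rot_hopf: "rot t (hopf x) = hopf (rot t x)"
  by (simp add: rot_def hopf_add hopf_scaleR)

lemma norm_rot [simp]: "norm (rot t x) = norm x"
  by (simp add: norm_eq_sqrt_inner)

lemma linear_rot: "linear (rot t)"
  by (rule linearI) (simp_all add: rot_def hopf_add hopf_scaleR algebra_simps)

lemma rot_rot: "rot s (rot t x) = rot (s + t) x"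
  by (simp add: rot_def hopf_add hopf_scaleR cos_add sin_add algebra_simps)

lemma rot_0 [simp]: "rot 0 x = x"
  by (simp add: rot_def)

subsection \<open>The Randers metric\<close>

text \<open>With \<open>p = hopf x \<bullet> v\<close>, squaring the navigation equation for the
  wind \<open>hopf x / 2\<close> gives
  \<open>3/4 * \<lambda>^2 + p * \<lambda> = v \<bullet> v\<close>. The formula is
  \<open>3/2\<close> times the root \<open>\<lambda>\<close> of this equation that is positive for
  \<open>v \<noteq> 0\<close>.\<close>

definition hopf_randers :: "real^4 \<Rightarrow> real^4 \<Rightarrow> real" where
  "hopf_randers x v = sqrt (3 * (v \<bullet> v) + (hopf x \<bullet> v)\<^sup>2) - hopf x \<bullet> v"

definition hopf_riem :: "real^4 \<Rightarrow> real^4 \<Rightarrow> real^4 \<Rightarrow> real" where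
  "hopf_riem x u v = 3 * (u \<bullet> v) + (hopf x \<bullet> u) * (hopf x \<bullet> v)"

lemma hopf_riem_pos: "v \<noteq> 0 \<Longrightarrow> hopf_riem x v v > 0"
  by (simp add: hopf_riem_def add_pos_nonneg)

lemma hopf_randers_alt: "hopf_randers x v = sqrt (hopf_riem x v v) - hopf x \<bullet> v"
  by (simp add: hopf_randers_def hopf_riem_def power2_eq_square)

lemma hopf_randers_pos:
  assumes "v \<noteq> 0" shows "hopf_randers x v > 0"
proof -
  have "\<bar>hopf x \<bullet> v\<bar> < sqrt (3 * (v \<bullet> v) + (hopf x \<bullet> v)\<^sup>2)"
    using assms by (intro real_less_rsqrt) auto
  then show ?thesis by (simp add: hopf_randers_def)
qed

text \<open>With both directions equal, the Hessian is the second derivative of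
  \<open>f^2 / 2\<close> for a function \<open>f\<close> of the single variable
  \<open>s + t\<close>. The two summands are \<open>f'^2\<close> and \<open>f * f''\<close> at
  0.\<close>

lemma hessian_half_square_sqrt_minus_linear:
  fixes A B C P R :: real
  assumes A: "A > 0"
  shows "deriv (\<lambda>s. deriv (\<lambda>t. (sqrt (A + 2 * B * (s + t) + C * (s + t)\<^sup>2) - (P + R * (s + t)))\<^sup>2 / 2) 0) 0
    = (B / sqrt A - R)\<^sup>2 + (sqrt A - P) * (C - B\<^sup>2 / A) / sqrt A"
proof -
  let ?q = "\<lambda>r. A + 2 * B * r + C * r\<^sup>2"
  let ?p = "\<lambda>r. P + R * r"
  let ?d = "\<lambda>r. (sqrt (?q r) - ?p r) * ((B + C * r) / sqrt (?q r) - R)"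
  have *: "deriv (\<lambda>t. (sqrt (?q (s + t)) - ?p (s + t))\<^sup>2 / 2) 0 = ?d s" if q: "?q s > 0" for s
    by (rule DERIV_imp_deriv) (rule derivative_eq_intros refl | use q in \<open>force simp: field_simps\<close>)+
  \<comment> \<open>The outer derivative at 0 only sees \<open>s\<close> near 0, where
    \<open>?q s\<close> remains positive and the formula for the inner derivative is valid.\<close>
  have "isCont ?q 0" by (intro continuous_intros)
  then have "(?q \<longlongrightarrow> ?q 0) (nhds 0)"
    using tendsto_at_iff_tendsto_nhds[of ?q 0] by (simp only: isCont_def)
  then have "eventually (\<lambda>s. ?q s > 0) (nhds 0)"
    using A by (intro order_tendstoD(1)) auto
  then have "deriv (\<lambda>s. deriv (\<lambda>t. (sqrt (?q (s + t)) - ?p (s + t))\<^sup>2 / 2) 0) 0 = deriv ?d 0"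
    by (intro deriv_cong_ev) (auto elim!: eventually_mono simp: *)
  also have "\<dots> = (B / sqrt A - R) * (B / sqrt A - R)
      + (sqrt A - P) * ((C * sqrt A - B * (B / sqrt A)) / (sqrt A * sqrt A))"
    by (rule DERIV_imp_deriv) (rule derivative_eq_intros refl | use A in \<open>force simp: field_simps\<close>)+
  also have "\<dots> = (B / sqrt A - R)\<^sup>2 + (sqrt A - P) * (C - B\<^sup>2 / A) / sqrt A"
  proof -
    have "C * sqrt A - B * (B / sqrt A) = sqrt A * (C - B\<^sup>2 / A)"
      using A by (simp add: field_simps power2_eq_square)
    then have "(sqrt A - P) * ((C * sqrt A - B * (B / sqrt A)) / (sqrt A * sqrt A))
        = (sqrt A - P) * ((C - B\<^sup>2 / A) / sqrt A)"
      using A mult_divide_mult_cancel_left[of "sqrt A" "C - B\<^sup>2 / A" "sqrt A"] by (simp only:) simp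
    then show ?thesis by (simp add: power2_eq_square)
  qed
  finally show ?thesis .
qed

text \<open>Both summands of the Hessian are nonnegative. The second vanishes only if
  \<open>u\<close> is a multiple of \<open>y\<close>, and then the first is positive.\<close>

lemma fundamental_tensor_hopf_randers_pos:
  assumes "y \<noteq> 0" "u \<noteq> 0"
  shows "fundamental_tensor hopf_randers x y u u > 0"
proof -
  define A B C where "A = hopf_riem x y y" and "B = hopf_riem x y u" and "C = hopf_riem x u u"
  define P R where "P = hopf x \<bullet> y" and "R = hopf x \<bullet> u"
  have A: "A > 0" using assms by (simp add: A_def hopf_riem_pos)
  have AP: "sqrt A - P > 0"
    using hopf_randers_pos[OF assms(1), of x] by (simp add: hopf_randers_alt A_def P_def)
  have F: "hopf_randers x (y + s *\<^sub>R u + t *\<^sub>R u) = sqrt (A + 2 * B * (s + t) + C * (s + t)\<^sup>2) - (P + R * (s + t))" for s t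
    by (simp add: hopf_randers_alt hopf_riem_def A_def B_def C_def P_def R_def inner_simps power2_eq_square
        inner_commute[of u y] algebra_simps)
  have ft: "fundamental_tensor hopf_randers x y u u = (B / sqrt A - R)\<^sup>2 + (sqrt A - P) * (C - B\<^sup>2 / A) / sqrt A"
    unfolding fundamental_tensor_def F by (rule hessian_half_square_sqrt_minus_linear[OF A])
  \<comment> \<open>\<open>w\<close> is the part of \<open>u\<close> orthogonal to \<open>y\<close>
    for \<open>hopf_riem x\<close>, so its squared length is the Cauchy-Schwarz defect
    \<open>C - B^2 / A\<close>.\<close>
  define w where "w = u - (B / A) *\<^sub>R y"
  have "hopf_riem x (u - k *\<^sub>R y) (u - k *\<^sub>R y) = C - 2 * k * B + k\<^sup>2 * A" for k
    by (simp add: hopf_riem_def A_def B_def C_def inner_simps power2_eq_square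
        inner_commute[of u y] algebra_simps)
  then have "hopf_riem x w w = C - 2 * (B / A) * B + (B / A)\<^sup>2 * A"
    unfolding w_def .
  also have "\<dots> = C - B\<^sup>2 / A"
    using A by (simp add: field_simps power2_eq_square)
  finally have w: "hopf_riem x w w = C - B\<^sup>2 / A" .
  show ?thesis
  proof (cases "w = 0")
    case False
    then have "(sqrt A - P) * (C - B\<^sup>2 / A) / sqrt A > 0"
      using hopf_riem_pos[OF False, of x] w A AP by simp
    then show ?thesis unfolding ft by (simp add: add_nonneg_pos)
  next
    case True
    then have u: "u = (B / A) *\<^sub>R y" by (simp add: w_def)
    then have "B \<noteq> 0" using assms by auto
    have "R = (B / A) * P" by (subst R_def, subst u) (simp add: P_def)
    moreover have "B / sqrt A = (B / A) * sqrt A"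
      using A by (simp add: field_simps)
    ultimately have "B / sqrt A - R = (B / A) * (sqrt A - P)"
      by (simp add: algebra_simps)
    then have "(B / sqrt A - R)\<^sup>2 > 0" using \<open>B \<noteq> 0\<close> A AP by simp
    moreover have "C - B\<^sup>2 / A = 0" using w True by (simp add: hopf_riem_def)
    ultimately show ?thesis unfolding ft by simp
  qed
qed

lemma smooth_hopf_randers: "smooth_on {(x, v). x \<in> S3 \<and> v \<in> tangent x \<and> v \<noteq> 0} (\<lambda>(x, v). hopf_randers x v)"
proof (rule smooth_on_Ck)
  \<comment> \<open>The expression under the root is positive whenever the vector is nonzero, at any
    base point of the ambient space, so one open set serves for all points.\<close>
  let ?U = "{p :: (real^4) \<times> (real^4). snd p \<noteq> 0}"
  show U: "open ?U" by (intro open_Collect_neq continuous_intros)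
  show "{(x, v). x \<in> S3 \<and> v \<in> tangent x \<and> v \<noteq> 0} \<subseteq> ?U" by auto
  fix k
  have v: "Ck_on k ?U snd"
    by (intro Ck_on_bounded_linear U bounded_linear_snd)
  have h: "Ck_on k ?U (\<lambda>p. hopf (fst p) \<bullet> snd p)"
    by (intro Ck_on_inner U v Ck_on_bounded_linear
        bounded_linear_compose[OF bounded_linear_hopf bounded_linear_fst])
  have q: "Ck_on k ?U (\<lambda>p. hopf_riem (fst p) (snd p) (snd p))"
    unfolding hopf_riem_def by (intro Ck_on_add Ck_on_mult Ck_on_const Ck_on_inner U v h)
  have "Ck_on k ?U (\<lambda>p. hopf_riem (fst p) (snd p) (snd p) powr (1/2) + - (hopf (fst p) \<bullet> snd p))"
    by (intro Ck_on_add Ck_on_minus Ck_on_powr U q h) (simp add: hopf_riem_pos)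
  moreover have "hopf_riem (fst p) (snd p) (snd p) powr (1/2) + - (hopf (fst p) \<bullet> snd p)
      = (\<lambda>(x, v). hopf_randers x v) p" if "p \<in> ?U" for p
    using that hopf_riem_pos[of "snd p" "fst p"]
    by (simp add: hopf_randers_alt powr_half_sqrt case_prod_beta)
  ultimately show "Ck_on k ?U (\<lambda>(x, v). hopf_randers x v)"
    by (rule Ck_on_cong[OF U, rotated])
qed

lemma finsler_hopf_randers: "finsler_metric hopf_randers"
  unfolding finsler_metric_def
proof (intro conjI ballI allI impI smooth_hopf_randers)
  fix x v :: "real^4" and c :: real
  assume "c \<ge> 0"
  have "3 * ((c *\<^sub>R v) \<bullet> (c *\<^sub>R v)) + (hopf x \<bullet> (c *\<^sub>R v))\<^sup>2 = c\<^sup>2 * (3 * (v \<bullet> v) + (hopf x \<bullet> v)\<^sup>2)"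
    by (simp add: power2_eq_square algebra_simps)
  then show "hopf_randers x (c *\<^sub>R v) = c * hopf_randers x v"
    using \<open>c \<ge> 0\<close> by (simp add: hopf_randers_def real_sqrt_mult right_diff_distrib)
qed (auto intro: hopf_randers_pos fundamental_tensor_hopf_randers_pos)

lemma smooth_on_const: "smooth_on S (\<lambda>x. c)"
  by (rule smooth_on_Ck[of UNIV]) (auto intro: Ck_on_const)

lemma riemannian_hopf_riem: "riemannian_metric hopf_riem"
  unfolding riemannian_metric_def
proof (intro conjI ballI allI impI)
  fix X Y assume "smooth_vector_field X \<and> smooth_vector_field Y"
  then have "smooth_on S3 X" "smooth_on S3 Y"
    by (simp_all add: smooth_vector_field_def)
  then show "smooth_on S3 (\<lambda>x. hopf_riem x (X x) (Y x))"
    unfolding hopf_riem_def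
    by (intro smooth_on_add smooth_on_mult smooth_on_inner smooth_on_const
        smooth_on_bounded_linear[OF bounded_linear_hopf])
qed (auto simp: hopf_riem_pos, auto simp: hopf_riem_def inner_simps algebra_simps inner_commute)

lemma one_form_hopf: "one_form (\<lambda>x v. - (hopf x \<bullet> v))"
  unfolding one_form_def
proof (intro conjI ballI allI impI)
  fix X assume "smooth_vector_field X"
  then have "smooth_on S3 X" by (simp add: smooth_vector_field_def)
  then show "smooth_on S3 (\<lambda>x. - (hopf x \<bullet> X x))"
    by (intro smooth_on_linear_compose[OF bounded_linear_minus[OF bounded_linear_ident]]
        smooth_on_inner smooth_on_bounded_linear[OF bounded_linear_hopf])
qed (simp add: inner_simps)

text \<open>With \<open>p = hopf x \<bullet> v\<close>, the conditions
  \<open>3 * (v \<bullet> v) + p^2 = 1\<close> and \<open>p^2 \<le> v \<bullet> v\<close> give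
  \<open>4 * p^2 \<le> 1\<close>.\<close>

lemma one_form_length_hopf:
  assumes "x \<in> S3"
  shows "one_form_length hopf_riem (\<lambda>x v. - (hopf x \<bullet> v)) x < 1"
proof -
  let ?V = "{v \<in> tangent x. hopf_riem x v v = 1}"
  \<comment> \<open>A supremum is bounded by a common upper bound only over a nonempty set; this
    vector has squared length \<open>3/4 + 1/4\<close>.\<close>
  have "(1/2) *\<^sub>R hopf x \<in> ?V"
    using assms by (simp add: tangent_def hopf_riem_def norm_eq_1)
  then have "?V \<noteq> {}" by blast
  moreover have "\<bar>- (hopf x \<bullet> v)\<bar> \<le> 1/2" if "v \<in> ?V" for v
  proof -
    have "(hopf x \<bullet> v)\<^sup>2 \<le> (norm (hopf x) * norm v)\<^sup>2"
      using Cauchy_Schwarz_ineq2[of "hopf x" v] by (metis abs_ge_zero power2_abs power_mono)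
    then have "(hopf x \<bullet> v)\<^sup>2 \<le> v \<bullet> v" using assms by (simp add: power2_norm_eq_inner)
    then have "(hopf x \<bullet> v)\<^sup>2 \<le> (1/2)\<^sup>2"
      using that by (simp add: hopf_riem_def power2_eq_square)
    then show ?thesis using abs_le_square_iff[of "hopf x \<bullet> v" "1/2"] by simp
  qed
  ultimately have "one_form_length hopf_riem (\<lambda>x v. - (hopf x \<bullet> v)) x \<le> 1/2"
    unfolding one_form_length_def by (rule cSUP_least)
  then show ?thesis by simp
qed

lemma non_riemannian_randers_hopf_randers: "non_riemannian_randers hopf_randers"
  unfolding non_riemannian_randers_def
proof (intro exI conjI)
  show "randers_metric hopf_randers hopf_riem (\<lambda>x v. - (hopf x \<bullet> v))"
    unfolding randers_metric_def
    using finsler_hopf_randers riemannian_hopf_riem one_form_hopf one_form_length_hopf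
    by (auto simp: hopf_randers_alt)
  have "axis 1 1 \<in> S3" by (simp add: norm_axis_1)
  then show "nonzero_form (\<lambda>x v. - (hopf x \<bullet> v))"
    unfolding nonzero_form_def by (intro bexI[of _ "axis 1 1"] bexI[of _ "hopf (axis 1 1)"])
      (auto simp: tangent_def norm_eq_1)
qed

subsection \<open>Isometries\<close>

text \<open>Composition with the great circle through \<open>x\<close> in direction \<open>u\<close>
  turns both candidate derivatives within the sphere into derivatives of one curve at time 0, where
  uniqueness holds.\<close>

lemma differential_unique:
  assumes D: "(f has_derivative D) (at x within S3)" and x: "x \<in> S3" and v: "v \<in> tangent x"
  shows "differential f x v = D v"
proof (cases "v = 0")
  case True
  have D': "(f has_derivative differential f x) (at x within S3)"
    using D unfolding differential_def by (intro frechet_derivative_works[THEN iffD1] differentiableI)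
  show ?thesis
    using True linear_0[OF has_derivative_linear[OF D]] linear_0[OF has_derivative_linear[OF D']] by simp
next
  case False
  have D': "(f has_derivative differential f x) (at x within S3)"
    using D unfolding differential_def by (intro frechet_derivative_works[THEN iffD1] differentiableI)
  define u where "u = v /\<^sub>R norm v"
  have xx: "x \<bullet> x = 1" using x by (simp add: norm_eq_1)
  have u: "u \<bullet> u = 1" "x \<bullet> u = 0" "u \<bullet> x = 0" "v = norm v *\<^sub>R u"
    using False v by (auto simp: u_def tangent_def inner_commute power2_norm_eq_inner[symmetric] power2_eq_square)
  define \<gamma> where "\<gamma> t = cos t *\<^sub>R x + sin t *\<^sub>R u" for t
  have \<gamma>: "(\<gamma> has_derivative (\<lambda>t. t *\<^sub>R u)) (at 0)"
    unfolding \<gamma>_def by (rule derivative_eq_intros refl | simp)+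
  have "\<gamma> t \<bullet> \<gamma> t = (cos t)\<^sup>2 + (sin t)\<^sup>2" for t
    using xx u by (simp add: \<gamma>_def inner_simps power2_eq_square)
  then have im: "range \<gamma> \<subseteq> S3" by (auto simp: norm_eq_1)
  have *: "((\<lambda>t. f (\<gamma> t)) has_derivative (\<lambda>t. E (t *\<^sub>R u))) (at 0)"
    if "(f has_derivative E) (at x within S3)" for E
    using has_derivative_in_compose[OF \<gamma>, of f E] has_derivative_subset[OF that im]
    by (simp add: \<gamma>_def[of 0])
  have "D u = differential f x u"
    using fun_cong[OF has_derivative_unique[OF *[OF D] *[OF D']], of 1] by simp
  then have "differential f x (norm v *\<^sub>R u) = D (norm v *\<^sub>R u)"
    by (simp add: linear_scale[OF has_derivative_linear[OF D]] linear_scale[OF has_derivative_linear[OF D']])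
  then show ?thesis using u(4) by simp
qed

text \<open>The metric is built from the inner product and \<open>hopf\<close> alone.
  \<open>T\<close> preserves the first, commutes with the second and, being linear, is its own
  differential.\<close>

lemma orthogonal_isometry:
  assumes T: "orthogonal_transformation T" and TJ: "\<And>x. T (hopf x) = hopf (T x)"
  shows "restrict T S3 \<in> isometries hopf_randers"
proof -
  have lin: "linear T" and inn: "T x \<bullet> T y = x \<bullet> y" for x y
    using T by (auto simp: orthogonal_transformation_def)
  have bl: "bounded_linear T" "bounded_linear (inv T)"
    using lin orthogonal_transformation_linear[OF orthogonal_transformation_inv[OF T]]
    by (simp_all add: linear_conv_bounded_linear)
  have bij: "bij T" using T by (rule orthogonal_transformation_bij)
  have S: "T x \<in> S3 \<longleftrightarrow> x \<in> S3" for x by (simp add: norm_eq_1 inn)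
  have TS: "T ` S3 = S3"
  proof
    show "T ` S3 \<subseteq> S3" using S by blast
    show "S3 \<subseteq> T ` S3"
    proof
      fix y assume "y \<in> S3"
      moreover have "y = T (inv T y)" using surj_f_inv_f[OF bij_is_surj[OF bij]] by simp
      ultimately show "y \<in> T ` S3" using S[of "inv T y"] by (intro image_eqI[of y T "inv T y"]) simp_all
    qed
  qed
  have b: "bij_betw (restrict T S3) S3 S3"
    unfolding bij_betw_def
    by (simp only: TS inj_on_restrict_eq image_restrict_eq inj_on_subset[OF bij_is_inj[OF bij]] simp_thms subset_UNIV)
  \<comment> \<open>Agreement with the linear map \<open>inv T\<close> on the sphere makes the
    inverse of the restricted map smooth.\<close>
  have i: "inv T y = inv_into S3 (restrict T S3) y" if "y \<in> S3" for y
  proof -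
    have "y \<in> T ` S3" using that by (simp only: TS)
    then obtain x where x: "y = T x" "x \<in> S3" ..
    have "inv_into S3 (restrict T S3) (restrict T S3 x) = x"
      using bij_betw_imp_inj_on[OF b] x(2) by (rule inv_into_f_f)
    then show ?thesis using x inv_f_f[OF bij_is_inj[OF bij], of x] by simp
  qed
  have d: "differential (restrict T S3) x v = T v" if "x \<in> S3" "v \<in> tangent x" for x v
    by (rule differential_unique[OF has_derivative_transform[OF that(1) _
          bounded_linear_imp_has_derivative[OF bl(1)]] that]) simp
  have "smooth_on S3 (restrict T S3)"
    by (rule smooth_on_cong[OF _ smooth_on_bounded_linear[OF bl(1)]]) simp
  moreover have "smooth_on S3 (inv_into S3 (restrict T S3))"
    by (rule smooth_on_cong[OF _ smooth_on_bounded_linear[OF bl(2)]]) (rule i)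
  ultimately show ?thesis
    using b unfolding isometries_def by (auto simp: d hopf_randers_def inn TJ[symmetric])
qed

section \<open>Left multiplications and homogeneity\<close>

lemma orthogonal_qmul: "a \<in> S3 \<Longrightarrow> orthogonal_transformation (qmul a)"
  using bounded_bilinear.bounded_linear_right[OF bilinear_qmul, of a]
  by (simp add: orthogonal_transformation_def qmul_inner norm_eq_1 linear_conv_bounded_linear norm_eq_1[THEN iffD1])

lemma orthogonal_rot: "orthogonal_transformation (rot t)"
  by (simp add: orthogonal_transformation_def linear_rot)

lemma qmul_isometry: "a \<in> S3 \<Longrightarrow> restrict (qmul a) S3 \<in> isometries hopf_randers"
  by (intro orthogonal_isometry orthogonal_qmul qmul_hopf)

lemma continuous_map_qmul:
  "continuous_map (top_of_set S3) (isometry_topology hopf_randers) (\<lambda>a. restrict (qmul a) S3)"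
  unfolding isometry_topology_def
proof (intro continuous_map_into_subtopology continuous_on_generated_topo)
  fix V :: "(real^4 \<Rightarrow> real^4) set"
  assume "V \<in> {{\<phi>. \<phi> ` K \<subseteq> U} | K U. compact K \<and> K \<subseteq> S3 \<and> open U}"
  then obtain K U where V: "V = {\<phi>. \<phi> ` K \<subseteq> U}" and K: "compact K" "K \<subseteq> S3" and U: "open U"
    by blast
  \<comment> \<open>The pairs \<open>(a, z)\<close> for which \<open>a\<close> moves
    \<open>z\<close> out of \<open>U\<close> form a compact set, so their projection, the set of bad
    \<open>a\<close>, is closed.\<close>
  let ?B = "{p \<in> S3 \<times> K. qmul (fst p) (snd p) \<in> - U}"
  have "closed ({p. qmul (fst p) (snd p) \<in> - U})"
    using U by (intro closed_vimage[of "- U", unfolded vimage_def]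
        bounded_bilinear.continuous_on[OF bilinear_qmul] continuous_intros) auto
  then have "compact ?B"
    using compact_Int_closed[OF compact_Times[OF compact_sphere[of 0 1] K(1)]]
    by (simp add: Collect_conj_eq)
  then have "closed (fst ` ?B)"
    by (intro compact_imp_closed compact_continuous_image continuous_intros)
  moreover have "(\<lambda>a. restrict (qmul a) S3) -` V \<inter> topspace (top_of_set S3) = S3 \<inter> - fst ` ?B"
    using K(2) by (fastforce simp: V image_subset_iff image_iff subset_eq)
  ultimately show "openin (top_of_set S3) ((\<lambda>a. restrict (qmul a) S3) -` V \<inter> topspace (top_of_set S3))"
    by (simp add: openin_open_Int open_Compl)
next
  let ?B = "{{\<phi> :: real^4 \<Rightarrow> real^4. \<phi> ` K \<subseteq> U} | K U. compact K \<and> K \<subseteq> S3 \<and> open U}"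
  \<comment> \<open>The empty set as \<open>K\<close> puts \<open>UNIV\<close> into the subbase, so
    every map is a point of the generated topology.\<close>
  have "UNIV \<in> ?B"
    by (intro CollectI exI[of _ "{}"] exI[of _ UNIV]) auto
  then show "(\<lambda>a. restrict (qmul a) S3) ` topspace (top_of_set S3) \<subseteq> \<Union> ?B"
    by blast
next
  show "(\<lambda>a. restrict (qmul a) S3) \<in> topspace (top_of_set S3) \<rightarrow> isometries hopf_randers"
    using qmul_isometry by auto
qed

lemma qmul_transitive:
  assumes "x \<in> S3" "y \<in> S3"
  obtains a where "a \<in> S3" "qmul a x = y"
  using that[of "qmul y (qcnj x)"] assms qmul_qcnj[of y x]
  by (simp add: norm_qmul power2_norm_eq_inner[symmetric])

lemma homogeneous_hopf_randers: "homogeneous hopf_randers"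
  unfolding homogeneous_def
proof (intro ballI)
  fix x y assume xy: "x \<in> S3" "y \<in> S3"
  let ?L = "\<lambda>a. restrict (qmul a) S3"
  have "connectedin (top_of_set S3) S3"
    by (simp add: connectedin_absolute connectedin_iff_connected connected_sphere)
  then have c: "connectedin (isometry_topology hopf_randers) (?L ` S3)"
    by (rule connectedin_continuous_map_image[OF continuous_map_qmul])
  \<comment> \<open>\<open>axis 1 1\<close> is the quaternion 1; through it the connected image of
    the sphere contains the identity.\<close>
  have "qmul (axis 1 1) z = z" for z
    by (simp add: vec4_eq_iff axis_def)
  then have "restrict id S3 = ?L (axis 1 1)" by (auto simp: fun_eq_iff)
  then have "restrict id S3 \<in> ?L ` S3"
    by (simp add: norm_axis_1)
  then have "?L ` S3 \<subseteq> identity_component hopf_randers"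
    unfolding identity_component_def by (rule connected_component_of_maximal[OF c])
  moreover obtain a where "a \<in> S3" "qmul a x = y" using qmul_transitive[OF xy] .
  ultimately show "\<exists>\<phi>\<in>identity_component hopf_randers. \<phi> x = y"
    using xy by (intro bexI[of _ "?L a"]) auto
qed

subsection \<open>Distance\<close>

text \<open>\<open>arccos\<close> is not differentiable at \<open>\<plusminus>1\<close>, so the estimate is made for
  \<open>arccos (k * (z \<bullet> \<psi> t))\<close> with \<open>k < 1\<close> before letting \<open>k\<close> tend to \<open>1\<close>.\<close>

lemma arccos_le_length_on_sphere:
  fixes \<psi> \<psi>' :: "real \<Rightarrow> 'a::euclidean_space"
  assumes P: "finite P" and ab: "a \<le> b"
    and c\<psi>: "continuous_on {a..b} \<psi>" and cl: "continuous_on {a..b} l"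
    and unit: "\<And>t. t \<in> {a..b} \<Longrightarrow> norm (\<psi> t) = 1"
    and d\<psi>: "\<And>t. t \<in> {a<..<b} - P \<Longrightarrow> (\<psi> has_vector_derivative \<psi>' t) (at t)"
    and dl: "\<And>t. t \<in> {a<..<b} - P \<Longrightarrow> (l has_real_derivative norm (\<psi>' t)) (at t)"
    and z: "norm z = 1"
  shows "arccos (z \<bullet> \<psi> b) - arccos (z \<bullet> \<psi> a) \<le> l b - l a"
proof -
  have u: "\<bar>z \<bullet> \<psi> t\<bar> \<le> 1" if "t \<in> {a..b}" for t
    using Cauchy_Schwarz_ineq2[of z "\<psi> t"] z unit[OF that] by simp
  have scaled: "arccos (k * (z \<bullet> \<psi> b)) - arccos (k * (z \<bullet> \<psi> a)) \<le> l b - l a"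
    if k: "0 < k" "k < 1" for k
  proof -
    define m where "m t = l t - arccos (k * (z \<bullet> \<psi> t))" for t
    \<comment> \<open>The value 0 at the end points and on \<open>P\<close> makes \<open>m'\<close>
      nonnegative everywhere, while the fundamental theorem tolerates finitely many
      exceptions.\<close>
    define m' where "m' t = (if t \<in> {a<..<b} - P then
        norm (\<psi>' t) + k * (z \<bullet> \<psi>' t) / sqrt (1 - (k * (z \<bullet> \<psi> t))\<^sup>2) else 0)" for t
    have ku: "\<bar>k * (z \<bullet> \<psi> t)\<bar> < 1" if "t \<in> {a..b}" for t
    proof -
      have "\<bar>k * (z \<bullet> \<psi> t)\<bar> = k * \<bar>z \<bullet> \<psi> t\<bar>" using k by (simp add: abs_mult)
      also have "\<dots> \<le> k * 1" using u[OF that] k by (intro mult_left_mono) auto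
      finally show ?thesis using k by simp
    qed
    have "(m has_vector_derivative m' t) (at t)" if t: "t \<in> {a<..<b} - P" for t
    proof -
      have "((\<lambda>t. k * (z \<bullet> \<psi> t)) has_vector_derivative k * (z \<bullet> \<psi>' t)) (at t)"
        by (intro has_vector_derivative_mult_right
            bounded_linear.has_vector_derivative[OF bounded_linear_inner_right] d\<psi> t)
      then have "((\<lambda>t. k * (z \<bullet> \<psi> t)) has_real_derivative k * (z \<bullet> \<psi>' t)) (at t)"
        by (simp add: has_real_derivative_iff_has_vector_derivative)
      moreover have "(arccos has_real_derivative inverse (- sqrt (1 - (k * (z \<bullet> \<psi> t))\<^sup>2))) (at (k * (z \<bullet> \<psi> t)))"
        using ku[of t] t by (intro DERIV_arccos) auto
      ultimately have "((\<lambda>t. arccos (k * (z \<bullet> \<psi> t))) has_real_derivative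
          inverse (- sqrt (1 - (k * (z \<bullet> \<psi> t))\<^sup>2)) * (k * (z \<bullet> \<psi>' t))) (at t)"
        by (rule DERIV_chain2[rotated])
      from DERIV_diff[OF dl[OF t] this] show ?thesis
        using t unfolding m_def m'_def has_real_derivative_iff_has_vector_derivative[symmetric]
        by (simp add: divide_inverse mult.commute)
    qed
    moreover have "continuous_on {a..b} m"
      unfolding m_def using ku by (intro continuous_intros cl c\<psi> ballI) (force simp: abs_less_iff)+
    ultimately have "(m' has_integral (m b - m a)) {a..b}"
      by (rule fundamental_theorem_of_calculus_interior_strong[OF P ab])
    moreover have "0 \<le> m' t" for t
    proof (cases "t \<in> {a<..<b} - P")
      case True
      \<comment> \<open>Constant norm makes \<open>\<psi>' t\<close> orthogonal to
        \<open>\<psi> t\<close>, so only the part of \<open>z\<close> orthogonal to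
        \<open>\<psi> t\<close> counts. Its norm is \<open>sqrt (1 - v^2)\<close>, and
        \<open>k^2 * (1 - v^2) \<le> 1 - (k * v)^2\<close> since \<open>k^2 \<le> 1\<close>.\<close>
      define v where "v = z \<bullet> \<psi> t"
      have n: "\<psi> t \<bullet> \<psi> t = 1" using unit[of t] True by (simp add: norm_eq_1)
      have "((\<lambda>t. \<psi> t \<bullet> \<psi> t) has_vector_derivative (\<psi> t \<bullet> \<psi>' t + \<psi>' t \<bullet> \<psi> t)) (at t)"
        by (rule bounded_bilinear.has_vector_derivative[OF bounded_bilinear_inner d\<psi>[OF True] d\<psi>[OF True]])
      moreover have "((\<lambda>t. \<psi> t \<bullet> \<psi> t) has_vector_derivative 0) (at t)"
      proof (rule has_vector_derivative_transform_within_open[where f="\<lambda>_. 1" and S="{a<..<b}"])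
        show "1 = \<psi> s \<bullet> \<psi> s" if "s \<in> {a<..<b}" for s
          using unit[of s] that by (simp add: norm_eq_1)
      qed (use True in auto)
      ultimately have "\<psi> t \<bullet> \<psi>' t + \<psi>' t \<bullet> \<psi> t = 0" by (rule vector_derivative_unique_at)
      then have perp: "\<psi> t \<bullet> \<psi>' t = 0" by (simp add: inner_commute)
      have v1: "v\<^sup>2 \<le> 1"
        using u[of t] True abs_square_le_1[of v] by (simp add: v_def)
      have kv: "(k * v)\<^sup>2 < 1"
        using ku[of t] True abs_square_less_1[of "k * v"] by (simp add: v_def)
      have "(norm (z - v *\<^sub>R \<psi> t))\<^sup>2 = 1 - v\<^sup>2"
        using z n unfolding power2_norm_eq_inner
        by (simp add: inner_simps norm_eq_1 v_def power2_eq_square inner_commute)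
      then have nz: "norm (z - v *\<^sub>R \<psi> t) = sqrt (1 - v\<^sup>2)"
        by (metis norm_ge_zero real_sqrt_unique)
      have "k * \<bar>z \<bullet> \<psi>' t\<bar> = k * \<bar>(z - v *\<^sub>R \<psi> t) \<bullet> \<psi>' t\<bar>"
        by (simp add: inner_simps perp)
      also have "\<dots> \<le> k * (sqrt (1 - v\<^sup>2) * norm (\<psi>' t))"
        using k Cauchy_Schwarz_ineq2[of "z - v *\<^sub>R \<psi> t" "\<psi>' t"] nz by (intro mult_left_mono) auto
      also have "\<dots> = sqrt (k\<^sup>2 * (1 - v\<^sup>2)) * norm (\<psi>' t)"
        using k by (simp add: real_sqrt_mult)
      also have "\<dots> \<le> sqrt (1 - (k * v)\<^sup>2) * norm (\<psi>' t)"
      proof -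
        have "k\<^sup>2 \<le> 1" using k by (simp add: power_le_one)
        then show ?thesis
          by (intro mult_right_mono real_sqrt_le_mono) (auto simp: power_mult_distrib algebra_simps)
      qed
      finally have "k * \<bar>z \<bullet> \<psi>' t\<bar> / sqrt (1 - (k * v)\<^sup>2) \<le> norm (\<psi>' t)"
        using kv by (simp add: divide_le_eq mult.commute)
      moreover have "- (k * \<bar>z \<bullet> \<psi>' t\<bar> / sqrt (1 - (k * v)\<^sup>2)) \<le> k * (z \<bullet> \<psi>' t) / sqrt (1 - (k * v)\<^sup>2)"
      proof -
        have "- (k * \<bar>z \<bullet> \<psi>' t\<bar>) \<le> k * (z \<bullet> \<psi>' t)"
          using mult_left_mono[of "- \<bar>z \<bullet> \<psi>' t\<bar>" "z \<bullet> \<psi>' t" k] k by simp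
        moreover have "0 \<le> sqrt (1 - (k * v)\<^sup>2)" using kv by simp
        ultimately show ?thesis
          unfolding minus_divide_left by (rule divide_right_mono)
      qed
      ultimately show ?thesis using True by (simp add: m'_def v_def)
    qed (auto simp: m'_def)
    ultimately have "0 \<le> m b - m a" by (rule has_integral_nonneg)
    then show ?thesis by (simp add: m_def)
  qed
  \<comment> \<open>\<open>arccos\<close> is still continuous at the ends of its domain, so the
    bound extends to \<open>k = 1\<close>.\<close>
  define g where "g k = arccos (k * (z \<bullet> \<psi> b)) - arccos (k * (z \<bullet> \<psi> a))" for k
  have bd: "-1 \<le> k * (z \<bullet> \<psi> t) \<and> k * (z \<bullet> \<psi> t) \<le> 1" if "k \<in> {0..1}" "t \<in> {a..b}" for k t
  proof -
    have "\<bar>k * (z \<bullet> \<psi> t)\<bar> \<le> 1 * 1"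
      using u[OF that(2)] that(1) unfolding abs_mult by (intro mult_mono) auto
    then show ?thesis by (simp add: abs_le_iff)
  qed
  have "continuous_on {0..1} g"
    unfolding g_def using bd ab by (intro continuous_intros ballI) auto
  then have "continuous_on (closure {0<..<1}) g" by simp
  then have "g 1 \<le> l b - l a"
    by (rule continuous_le_on_closure) (auto simp: g_def scaled)
  then show ?thesis by (simp add: g_def)
qed

text \<open>The product rule: varying the angle adds \<open>\<theta>'\<close> times the Hopf field,
  which \<open>rot\<close> carries along because it commutes with \<open>hopf\<close>.\<close>

lemma rot_has_vector_derivative:
  assumes "(\<theta> has_real_derivative \<theta>') (at t within S)" "(\<psi> has_vector_derivative \<psi>') (at t within S)"
  shows "((\<lambda>t. rot (\<theta> t) (\<psi> t)) has_vector_derivative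
    rot (\<theta> t) (\<psi>' + \<theta>' *\<^sub>R hopf (\<psi> t))) (at t within S)"
proof -
  have h: "((\<lambda>t. hopf (\<psi> t)) has_vector_derivative hopf \<psi>') (at t within S)"
    by (rule bounded_linear.has_vector_derivative[OF bounded_linear_hopf assms(2)])
  have c: "((\<lambda>t. cos (\<theta> t)) has_real_derivative - sin (\<theta> t) * \<theta>') (at t within S)"
    and s: "((\<lambda>t. sin (\<theta> t)) has_real_derivative cos (\<theta> t) * \<theta>') (at t within S)"
    using assms(1) by (auto intro!: derivative_eq_intros)
  show ?thesis
    using has_vector_derivative_add[OF has_vector_derivative_scaleR[OF c assms(2)]
        has_vector_derivative_scaleR[OF s h]]
    by (simp add: rot_def hopf_add hopf_scaleR algebra_simps)
qed

lemma hopf_randers_rot: "hopf_randers (rot t x) (rot t v) = hopf_randers x v"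
  by (simp add: hopf_randers_def rot_hopf[symmetric])

lemma hopf_randers_nonneg: "hopf_randers x v \<ge> 0"
proof (cases "v = 0")
  case False
  then show ?thesis using hopf_randers_pos[of v x] by simp
qed (simp add: hopf_randers_def)

text \<open>The equation \<open>\<bar>v - \<lambda> W\<bar> = \<lambda>\<close> that defines the navigation metric, for
  \<open>W = hopf x / 2\<close> and \<open>\<lambda> = 2/3 * hopf_randers x v\<close>.\<close>

lemma norm_minus_wind:
  assumes "x \<in> S3"
  shows "norm (v - (hopf_randers x v / 3) *\<^sub>R hopf x) = 2/3 * hopf_randers x v"
proof -
  define p F where "p = hopf x \<bullet> v" and "F = hopf_randers x v"
  have "(F + p)\<^sup>2 = 3 * (v \<bullet> v) + p\<^sup>2"
    by (simp add: F_def p_def hopf_randers_def)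
  then have F: "3 * (v \<bullet> v) = F\<^sup>2 + 2 * F * p"
    unfolding power2_sum by linarith
  have h: "hopf x \<bullet> hopf x = 1" using assms by (simp add: norm_eq_1)
  have "(v - k *\<^sub>R hopf x) \<bullet> (v - k *\<^sub>R hopf x) = v \<bullet> v - 2 * k * p + k * k" for k
    unfolding inner_diff_left inner_diff_right inner_scaleR_left inner_scaleR_right h p_def
      inner_commute[of v "hopf x"]
    by (simp add: algebra_simps)
  from this[of "F / 3"] have "(norm (v - (F / 3) *\<^sub>R hopf x))\<^sup>2 = v \<bullet> v - 2 * (F / 3) * p + (F / 3) * (F / 3)"
    unfolding power2_norm_eq_inner .
  also have "v \<bullet> v = (F\<^sup>2 + 2 * F * p) / 3" using F by simp
  also have "(F\<^sup>2 + 2 * F * p) / 3 - 2 * (F / 3) * p + (F / 3) * (F / 3) = (2/3 * F)\<^sup>2"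
    by (simp add: power2_eq_square add_divide_distrib)
  finally have "(norm (v - (F / 3) *\<^sub>R hopf x))\<^sup>2 = (2/3 * F)\<^sup>2" .
  then show ?thesis
    unfolding F_def by (rule power2_eq_imp_eq) (use hopf_randers_nonneg[of x v] in simp_all)
qed

text \<open>Induction on the break points: \<open>p\<close> splits the interval if it lies inside
  and is harmless otherwise. The hypothesis about all subintervals passes to both halves.\<close>

lemma integrable_on_piecewise:
  fixes f :: "real \<Rightarrow> 'a::banach"
  assumes "finite P" "a \<le> b"
    and "\<And>s t. a \<le> s \<Longrightarrow> s < t \<Longrightarrow> t \<le> b \<Longrightarrow> {s<..<t} \<inter> P = {} \<Longrightarrow> f integrable_on {s..t}"
  shows "f integrable_on {a..b}"
  using assms
proof (induction P arbitrary: a b)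
  case empty
  have "f integrable_on cbox b b" by (rule integrable_on_refl)
  then show ?case using empty by (cases "a = b") auto
next
  case (insert p P)
  have split: "f integrable_on {c..d}" if cd: "a \<le> c" "c \<le> d" "d \<le> b" "p \<notin> {c<..<d}" for c d
  proof (rule insert.IH[OF cd(2)])
    fix s t assume st: "c \<le> s" "s < t" "t \<le> d" "{s<..<t} \<inter> P = {}"
    have "p \<notin> {s<..<t}" using st cd by auto
    then have e: "{s<..<t} \<inter> insert p P = {}" using st(4) by simp
    have "a \<le> s" "t \<le> b" using st cd by simp_all
    from insert.prems(2)[OF this(1) st(2) this(2) e] show "f integrable_on {s..t}" .
  qed
  show ?case
  proof (cases "a < p \<and> p < b")
    case True
    then show ?thesis
      by (intro Henstock_Kurzweil_Integration.integrable_combine[of a p b] split) auto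
  next
    case False
    then show ?thesis using insert.prems(1) by (intro split) auto
  qed
qed

lemma continuous_on_hopf_randers:
  assumes "continuous_on S c" "continuous_on S v"
  shows "continuous_on S (\<lambda>t. hopf_randers (c t) (v t))"
  unfolding hopf_randers_def
  by (intro continuous_intros assms bounded_linear.continuous_on[OF bounded_linear_hopf])

text \<open>Supplies what differentiating the running length requires: an integrable speed that is
  continuous, along with a genuine velocity, off a finite set.\<close>

lemma piecewise_smooth_speed:
  assumes "piecewise_smooth c"
    and v: "\<And>t. v t = vector_derivative c (at t within {0..1})"
    and f: "\<And>t. f t = hopf_randers (c t) (v t)"
  obtains P where "finite P"
    and "\<And>t. t \<in> {0<..<1} - P \<Longrightarrow> (c has_vector_derivative v t) (at t)"
    and "\<And>t. t \<in> {0<..<1} - P \<Longrightarrow> isCont f t"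
    and "f integrable_on {0..1}"
proof -
  obtain P where P': "finite P \<and> (\<forall>s t. 0 \<le> s \<and> s < t \<and> t \<le> 1 \<and> {s<..<t} \<inter> P = {} \<longrightarrow>
      smooth_on {s..t} c)"
    using conjunct2[OF assms(1)[unfolded piecewise_smooth_def]] ..
  then have P: "finite P" ..
  have sm: "smooth_on {s..t} c" if "0 \<le> s" "s < t" "t \<le> 1" "{s<..<t} \<inter> P = {}" for s t
    by (intro P'[THEN conjunct2, rule_format] conjI that)
  have cc: "continuous_on {0..1} c" using assms(1) by (simp add: piecewise_smooth_def)
  have piece: "(\<forall>r\<in>{s<..<t}. (c has_vector_derivative v r) (at r) \<and> isCont f r) \<and> f integrable_on {s..t}"
    if st: "0 \<le> s" "s < t" "t \<le> 1" "{s<..<t} \<inter> P = {}" for s t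
  proof -
    \<comment> \<open>\<open>w\<close> is one-sided at the ends of the piece and hence continuous up
      to them. It agrees with \<open>v\<close> in the interior, and two points do not affect
      integrability.\<close>
    define w where "w r = vector_derivative c (at r within {s..t})" for r
    have w: "\<And>r. r \<in> {s..t} \<Longrightarrow> (c has_vector_derivative w r) (at r within {s..t})"
      and cw: "continuous_on {s..t} w"
      using smooth_curve_derivative[OF sm[OF st] st(2)] by (simp_all add: w_def)
    have w': "(c has_vector_derivative w r) (at r)" if "r \<in> {s<..<t}" for r
      using w[of r] that by (simp add: at_within_Icc_at)
    have vw: "v r = w r" if "r \<in> {s<..<t}" for r
      unfolding v using st that
      by (intro vector_derivative_within_closed_interval has_vector_derivative_at_within[OF w'[OF that]]) auto
    have cF: "continuous_on {s..t} (\<lambda>r. hopf_randers (c r) (w r))"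
      by (intro continuous_on_hopf_randers cw continuous_on_subset[OF cc]) (use st in auto)
    have "f integrable_on {s..t}"
      by (rule integrable_spike_finite[where S="{s, t}" and f="\<lambda>r. hopf_randers (c r) (w r)"])
        (auto simp: f vw intro: integrable_continuous_interval cF)
    moreover have "isCont f r" if "r \<in> {s<..<t}" for r
    proof -
      have "continuous_on {s<..<t} (\<lambda>r. hopf_randers (c r) (w r))"
        by (rule continuous_on_subset[OF cF]) auto
      then have "continuous_on {s<..<t} f"
        by (rule continuous_on_cong[THEN iffD1, rotated -1]) (auto simp: f vw)
      then show ?thesis using that by (simp add: continuous_on_eq_continuous_at)
    qed
    ultimately show ?thesis using w' vw by simp
  qed
  have int: "f integrable_on {0..1}"
    by (rule integrable_on_piecewise[OF P]) (use piece in auto)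
  have near: "(c has_vector_derivative v r) (at r) \<and> isCont f r" if r: "r \<in> {0<..<1} - P" for r
  proof -
    \<comment> \<open>A finite set is closed, so \<open>r\<close> is the midpoint of a closed
      interval without break points.\<close>
    have "open ({0<..<1} - P)" by (intro open_Diff finite_imp_closed P) auto
    then have "\<exists>e>0. cball r e \<subseteq> {0<..<1} - P"
      unfolding open_contains_cball using r by (rule bspec)
    then obtain e where e: "e > 0" "cball r e \<subseteq> {0<..<1} - P" by (elim exE conjE)
    have sub: "{r - e..r + e} \<subseteq> {0<..<1} - P" using e(2) by (simp add: cball_eq_atLeastAtMost)
    then have "r - e \<in> {0<..<1}" "r + e \<in> {0<..<1}" "{r - e<..<r + e} \<inter> P = {}"
      using e(1) subsetD[OF sub] by force+
    then show ?thesis using piece[of "r - e" "r + e"] e(1) by simp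
  qed
  show ?thesis
    by (rule that[OF P near[THEN conjunct1] near[THEN conjunct2] int])
qed

text \<open>Undoing the drift of the wind up to each moment leaves a curve \<open>\<psi>\<close> on
  the sphere whose round speed is \<open>2/3\<close> of the Randers speed of \<open>c\<close>; the
  round angle between its ends is at most its round length.\<close>

lemma arccos_le_hopf_randers_length:
  assumes c: "piecewise_smooth c" "path_image c \<subseteq> S3"
  shows "arccos (pathstart c \<bullet> rot (- finsler_length hopf_randers c / 3) (pathfinish c)) \<le> 2/3 * finsler_length hopf_randers c"
proof -
  define v where "v t = vector_derivative c (at t within {0..1})" for t
  define f where "f t = hopf_randers (c t) (v t)" for t
  obtain P where P: "finite P"
    and dc: "\<And>t. t \<in> {0<..<1} - P \<Longrightarrow> (c has_vector_derivative v t) (at t)"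
    and cf: "\<And>t. t \<in> {0<..<1} - P \<Longrightarrow> isCont f t"
    and int: "f integrable_on {0..1}"
    by (rule piecewise_smooth_speed[OF c(1) v_def f_def]) (rule that)
  \<comment> \<open>\<open>l\<close> is the elapsed navigation time. Its derivative
    \<open>2/3 * f t\<close> gives the coefficient \<open>- f t / 3\<close> in
    \<open>\<psi>'\<close>, as \<open>norm_minus_wind\<close> requires.\<close>
  define l where "l t = 2/3 * integral {0..t} f" for t
  define \<psi> where "\<psi> t = rot (- l t / 2) (c t)" for t
  define \<psi>' where "\<psi>' t = rot (- l t / 2) (v t + (- f t / 3) *\<^sub>R hopf (c t))" for t
  have cS: "c t \<in> S3" if "t \<in> {0..1}" for t
    using subsetD[OF c(2)[unfolded path_image_def] imageI[OF that]] .
  have cc: "continuous_on {0..1} c" using c(1) by (simp add: piecewise_smooth_def)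
  have cl: "continuous_on {0..1} l"
    unfolding l_def by (intro continuous_intros indefinite_integral_continuous_1 int)
  have dl: "(l has_real_derivative 2/3 * f t) (at t)" if t: "t \<in> {0<..<1} - P" for t
  proof -
    have "((\<lambda>u. integral {0..u} f) has_vector_derivative f t) (at t within ({0..1} - {}))"
      using t cf[OF t] int
      by (intro integral_has_vector_derivative_continuous_at) (auto intro: continuous_at_imp_continuous_at_within)
    then have "((\<lambda>u. integral {0..u} f) has_real_derivative f t) (at t)"
      using t by (simp add: has_real_derivative_iff_has_vector_derivative at_within_Icc_at)
    then show ?thesis unfolding l_def by (rule DERIV_cmult)
  qed
  have "arccos (c 0 \<bullet> \<psi> 1) - arccos (c 0 \<bullet> \<psi> 0) \<le> l 1 - l 0"
  proof (rule arccos_le_length_on_sphere[OF P _ _ cl, where \<psi>'=\<psi>'])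
    show "continuous_on {0..1} \<psi>"
      unfolding \<psi>_def rot_def
      by (intro continuous_intros cl cc bounded_linear.continuous_on[OF bounded_linear_hopf]) simp_all
    show "norm (\<psi> t) = 1" if "t \<in> {0..1}" for t
      using cS[OF that] by (simp add: \<psi>_def)
    show "norm (c 0) = 1" using cS[of 0] by simp
    fix t :: real assume t: "t \<in> {0<..<1} - P"
    have "((\<lambda>t. - l t / 2) has_real_derivative - f t / 3) (at t)"
      using DERIV_cmult[OF dl[OF t], of "-1/2"] by simp
    from rot_has_vector_derivative[OF this dc[OF t]] show "(\<psi> has_vector_derivative \<psi>' t) (at t)"
      unfolding \<psi>_def \<psi>'_def .
    have "norm (\<psi>' t) = 2/3 * f t"
      using norm_minus_wind[of "c t" "v t"] cS[of t] t by (simp add: \<psi>'_def f_def)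
    then show "(l has_real_derivative norm (\<psi>' t)) (at t)" using dl[OF t] by (simp only:)
  qed simp
  moreover have "\<psi> 0 = c 0" "l 0 = 0" "c 0 \<bullet> c 0 = 1"
    using cS[of 0] by (simp_all add: \<psi>_def l_def norm_eq_1)
  moreover have "l 1 = 2/3 * finsler_length hopf_randers c"
    by (simp add: l_def finsler_length_def f_def[abs_def] v_def[abs_def])
  ultimately show ?thesis by (simp add: \<psi>_def pathstart_def pathfinish_def)
qed

text \<open>A shorter curve would arrive at a time \<open>T < t\<close>, with angle at most
  \<open>T\<close> between \<open>x\<close> and \<open>rot (- T / 2) y\<close>. Drifting on to
  \<open>rot (- t / 2) y\<close> at speed \<open>1/2\<close> adds at most
  \<open>(t - T) / 2\<close>, so the angle \<open>t\<close> would be at most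
  \<open>(T + t) / 2\<close>, which is less than \<open>t\<close>.\<close>

lemma hopf_randers_length_ge:
  assumes c: "piecewise_smooth c" "path_image c \<subseteq> S3" "pathstart c = x" "pathfinish c = y"
    and t: "0 \<le> t" "t \<le> pi" and xy: "rot (t/2) x \<bullet> y = cos t"
  shows "3/2 * t \<le> finsler_length hopf_randers c"
proof (rule ccontr)
  define T where "T = 2/3 * finsler_length hopf_randers c"
  assume "\<not> ?thesis"
  then have T: "T < t" by (simp add: T_def)
  have S: "norm x = 1" "norm y = 1"
    using c(2) pathstart_in_path_image[of c] pathfinish_in_path_image[of c] c(3,4) by auto
  have "arccos (x \<bullet> rot (- T / 2) y) \<le> T"
    using arccos_le_hopf_randers_length[OF c(1,2)] c(3,4) by (simp add: T_def)
  moreover have "arccos (x \<bullet> rot (- t / 2) y) - arccos (x \<bullet> rot (- T / 2) y) \<le> t / 2 - T / 2"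
  proof (rule arccos_le_length_on_sphere[where P="{}" and \<psi>'="\<lambda>s. rot (- s / 2) ((-1/2) *\<^sub>R hopf y)"])
    show "continuous_on {T..t} (\<lambda>s. rot (- s / 2) y)"
      unfolding rot_def by (intro continuous_intros) simp_all
    fix s :: real
    have "((\<lambda>s. - s / 2) has_real_derivative - 1 / 2) (at s)"
      by (auto intro!: derivative_eq_intros)
    from rot_has_vector_derivative[OF this has_vector_derivative_const[of y]]
    show "((\<lambda>s. rot (- s / 2) y) has_vector_derivative rot (- s / 2) ((-1/2) *\<^sub>R hopf y)) (at s)"
      by simp
    show "((\<lambda>s. s / 2) has_real_derivative norm (rot (- s / 2) ((-1/2) *\<^sub>R hopf y))) (at s)"
      using S by (auto intro!: derivative_eq_intros)
  qed (use S T in \<open>auto intro!: continuous_intros\<close>)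
  moreover have "x \<bullet> rot (- t / 2) y = cos t"
    using xy rot_inner[of "t/2" x "rot (- t / 2) y"] by (simp add: rot_rot)
  ultimately show False using T t by (simp add: arccos_cos)
qed

section \<open>Curves that attain the distance\<close>

lemma great_circle_between:
  assumes z: "z \<in> S3" and y: "y \<in> S3" and zy: "z \<bullet> y = cos t"
  obtains n where "n \<bullet> n = 1" "z \<bullet> n = 0" "y = cos t *\<^sub>R z + sin t *\<^sub>R n"
proof (cases "sin t = 0")
  case True
  have zz: "z \<bullet> z = 1" "y \<bullet> y = 1" using z y by (simp_all add: norm_eq_1)
  have "cos t * cos t = 1" using sin_cos_squared_add[of t] True by (simp add: power2_eq_square)
  then have "(y - cos t *\<^sub>R z) \<bullet> (y - cos t *\<^sub>R z) = 0"
    using zz zy by (simp add: inner_simps inner_commute[of y z])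
  then have "y = cos t *\<^sub>R z" by simp
  \<comment> \<open>Here \<open>y\<close> is \<open>z\<close> or \<open>- z\<close>, and any unit
    vector orthogonal to \<open>z\<close> would do.\<close>
  then show ?thesis using that[of "hopf z"] zz True by simp
next
  case False
  have zz: "z \<bullet> z = 1" "y \<bullet> y = 1" using z y by (simp_all add: norm_eq_1)
  \<comment> \<open>The part of \<open>y\<close> orthogonal to \<open>z\<close> has length
    \<open>\<bar>sin t\<bar>\<close>; division by \<open>sin t\<close> itself gives the sign
    required by the formula for \<open>y\<close>.\<close>
  define n where "n = (1 / sin t) *\<^sub>R (y - cos t *\<^sub>R z)"
  have "(y - cos t *\<^sub>R z) \<bullet> (y - cos t *\<^sub>R z) = 1 - cos t * cos t"
    using zz zy by (simp add: inner_simps inner_commute[of y z])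
  also have "\<dots> = sin t * sin t"
    using sin_cos_squared_add[of t] by (simp add: power2_eq_square)
  finally have "n \<bullet> n = 1" using False by (simp add: n_def)
  moreover have "z \<bullet> n = 0" using zz zy by (simp add: n_def inner_simps)
  moreover have "y = cos t *\<^sub>R z + sin t *\<^sub>R n" using False by (simp add: n_def)
  ultimately show ?thesis by (rule that)
qed

lemma hopf_randers_geodesic:
  assumes x: "x \<in> S3" and y: "y \<in> S3" and t: "0 \<le> t" and xy: "rot (t/2) x \<bullet> y = cos t"
  obtains c where "piecewise_smooth c" "path_image c \<subseteq> S3" "pathstart c = x" "pathfinish c = y"
    "finsler_length hopf_randers c = 3/2 * t"
proof -
  define z where "z = rot (t/2) x"
  have zS: "z \<in> S3" using x by (simp add: z_def)
  then have zz: "z \<bullet> z = 1" by (simp add: norm_eq_1)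
  obtain n where n: "n \<bullet> n = 1" "z \<bullet> n = 0" "y = cos t *\<^sub>R z + sin t *\<^sub>R n"
    using great_circle_between[OF zS y xy[folded z_def]] .
  have nz: "n \<bullet> z = 0" using n(2) by (simp add: inner_commute)
  define \<psi> \<psi>' where "\<psi> s = cos (t * s) *\<^sub>R z + sin (t * s) *\<^sub>R n"
    and "\<psi>' s = t *\<^sub>R (cos (t * s) *\<^sub>R n - sin (t * s) *\<^sub>R z)" for s
  \<comment> \<open>The great circle \<open>\<psi>\<close> from \<open>z\<close> to \<open>y\<close>
    is set adrift. The shift by \<open>- (t / 2)\<close> makes the curve start at
    \<open>rot (- (t / 2)) z = x\<close> and leaves its end \<open>y\<close> unrotated.\<close>
  define c where "c s = rot (t / 2 * s + - (t / 2)) (\<psi> s)" for s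
  have cs: "cos a * cos a + sin a * sin a = 1" for a :: real
    using sin_cos_squared_add2[of a] by (simp add: power2_eq_square)
  have \<psi>\<psi>: "\<psi> s \<bullet> \<psi> s = 1" "\<psi>' s \<bullet> \<psi>' s = t\<^sup>2" for s
    using n(1,2) nz zz cs[of "t * s"]
    by (simp_all add: \<psi>_def \<psi>'_def inner_simps power2_eq_square algebra_simps flip: distrib_left)
  have cS: "c s \<in> S3" for s by (simp add: c_def norm_eq_1 \<psi>\<psi>)
  have d\<psi>: "(\<psi> has_vector_derivative \<psi>' s) (at s within S)" for s S
    unfolding \<psi>_def \<psi>'_def
    by (rule derivative_eq_intros refl | simp add: algebra_simps)+
  have dc: "(c has_vector_derivative rot (t / 2 * s + - (t / 2)) (\<psi>' s + (t / 2) *\<^sub>R hopf (\<psi> s))) (at s within S)" for s S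
    unfolding c_def
    by (rule rot_has_vector_derivative[OF _ d\<psi>]) (auto intro!: derivative_eq_intros)
  have speed: "hopf_randers (\<psi> s) (\<psi>' s + (t / 2) *\<^sub>R hopf (\<psi> s)) = 3/2 * t" for s
  proof -
    \<comment> \<open>The bound \<open>\<bar>m\<bar> \<le> t\<close> fixes the sign of the square
      root as \<open>2 * t + m\<close>, after which \<open>m\<close> cancels and the speed is
      constant.\<close>
    define m where "m = hopf (\<psi> s) \<bullet> \<psi>' s"
    have "\<bar>m\<bar> \<le> norm (\<psi> s) * norm (\<psi>' s)"
      unfolding m_def using Cauchy_Schwarz_ineq2[of "hopf (\<psi> s)" "\<psi>' s"] by simp
    then have m: "\<bar>m\<bar> \<le> t" using t by (simp add: norm_eq_sqrt_inner \<psi>\<psi>)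
    have "3 * ((\<psi>' s + (t / 2) *\<^sub>R hopf (\<psi> s)) \<bullet> (\<psi>' s + (t / 2) *\<^sub>R hopf (\<psi> s)))
        + (m + t / 2)\<^sup>2 = (2 * t + m)\<^sup>2"
      by (simp add: inner_simps \<psi>\<psi> inner_commute[of "\<psi>' s"] m_def[symmetric] power2_eq_square field_simps)
    moreover have "hopf (\<psi> s) \<bullet> (\<psi>' s + (t / 2) *\<^sub>R hopf (\<psi> s)) = m + t / 2"
      by (simp add: inner_simps \<psi>\<psi> m_def)
    ultimately have "hopf_randers (\<psi> s) (\<psi>' s + (t / 2) *\<^sub>R hopf (\<psi> s)) = \<bar>2 * t + m\<bar> - (m + t / 2)"
      unfolding hopf_randers_def by simp
    then show ?thesis using m t by (simp add: abs_le_iff)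
  qed
  have smooth: "smooth_on S c" for S
  proof (rule smooth_on_Ck)
    fix k
    have aff: "Ck_on k UNIV (\<lambda>s::real. a * s + b)" for a b
      by (intro Ck_on_add Ck_on_const Ck_on_bounded_linear bounded_linear_mult_right open_UNIV)
    have lin: "Ck_on k UNIV (\<lambda>s::real. a * s)" for a
      by (intro Ck_on_bounded_linear bounded_linear_mult_right open_UNIV)
    have "Ck_on k UNIV \<psi>"
      unfolding \<psi>_def
      by (intro Ck_on_add Ck_on_scaleR Ck_on_const open_UNIV
          Ck_on_cos_sin[THEN conjunct1] Ck_on_cos_sin[THEN conjunct2] lin)
    then show "Ck_on k UNIV c"
      unfolding c_def rot_def
      by (intro Ck_on_add Ck_on_scaleR Ck_on_linear_compose[OF bounded_linear_hopf] open_UNIV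
          Ck_on_cos_sin[THEN conjunct1] Ck_on_cos_sin[THEN conjunct2] aff)
  qed auto
  show ?thesis
  proof
    have "continuous_on {0..1} c"
      unfolding continuous_on_eq_continuous_within
      by (intro ballI has_vector_derivative_continuous[OF dc])
    then show "piecewise_smooth c"
      unfolding piecewise_smooth_def using smooth by (intro conjI exI[of _ "{}"]) auto
    show "path_image c \<subseteq> S3" using cS by (auto simp: path_image_def simp del: mem_sphere_0)
    show "pathstart c = x" by (simp add: pathstart_def c_def \<psi>_def z_def rot_rot)
    show "pathfinish c = y" by (simp add: pathfinish_def c_def \<psi>_def n(3)[symmetric])
    have "finsler_length hopf_randers c = integral {0..1} (\<lambda>s::real. 3/2 * t)"
      unfolding finsler_length_def
    proof (rule integral_cong)
      fix s :: real assume "s \<in> {0..1}"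
      then have "vector_derivative c (at s within {0..1})
          = rot (t / 2 * s + - (t / 2)) (\<psi>' s + (t / 2) *\<^sub>R hopf (\<psi> s))"
        by (intro vector_derivative_within_closed_interval dc) auto
      then show "hopf_randers (c s) (vector_derivative c (at s within {0..1})) = 3/2 * t"
        by (simp only: c_def hopf_randers_rot speed)
    qed
    then show "finsler_length hopf_randers c = 3/2 * t" by simp
  qed
qed

lemma finsler_dist_hopf_randers:
  assumes "x \<in> S3" "y \<in> S3" "0 \<le> t" "t \<le> pi" "rot (t/2) x \<bullet> y = cos t"
  shows "finsler_dist hopf_randers x y = 3/2 * t"
  unfolding finsler_dist_def
proof (rule cInf_eq_minimum)
  obtain c where "piecewise_smooth c" "path_image c \<subseteq> S3" "pathstart c = x" "pathfinish c = y"
    "finsler_length hopf_randers c = 3/2 * t"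
    using hopf_randers_geodesic[OF assms(1,2,3,5)] .
  then show "3/2 * t \<in> {finsler_length hopf_randers c |c. piecewise_smooth c \<and> path_image c \<subseteq> S3 \<and>
      pathstart c = x \<and> pathfinish c = y}"
    by (intro CollectI exI[of _ c]) simp
qed (use hopf_randers_length_ge[OF _ _ _ _ assms(3,4,5)] in blast)

subsection \<open>Clifford-Wolf homogeneity\<close>

lemma CW_homogeneous_hopf_randers: "CW_homogeneous hopf_randers"
  unfolding CW_homogeneous_def
proof (intro ballI)
  fix x\<^sub>1 x\<^sub>2 :: "real^4" assume x: "x\<^sub>1 \<in> S3" "x\<^sub>2 \<in> S3"
  have cs: "\<bar>rot s x\<^sub>1 \<bullet> x\<^sub>2\<bar> \<le> 1" for s
    using Cauchy_Schwarz_ineq2[of "rot s x\<^sub>1" x\<^sub>2] x by simp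
  \<comment> \<open>The difference is at most \<open>1 - 1\<close> at \<open>t = 0\<close> and at
    least \<open>-1 + 1\<close> at \<open>t = pi\<close>, both by \<open>cs\<close>.\<close>
  have "continuous_on {0..pi} (\<lambda>t. rot (t/2) x\<^sub>1 \<bullet> x\<^sub>2 - cos t)"
    unfolding rot_def by (intro continuous_intros) simp_all
  then have "\<exists>t\<ge>0. t \<le> pi \<and> rot (t/2) x\<^sub>1 \<bullet> x\<^sub>2 - cos t = 0"
    using cs[of 0] cs[of "pi/2"] by (intro IVT') (simp_all add: abs_le_iff)
  then obtain t where t: "0 \<le> t" "t \<le> pi" "rot (t/2) x\<^sub>1 \<bullet> x\<^sub>2 = cos t" by auto
  have rS: "rot (t/2) x \<in> S3" if "x \<in> S3" for x using that by simp
  obtain a where a: "a \<in> S3" "qmul a (rot (t/2) x\<^sub>1) = x\<^sub>2"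
    using qmul_transitive[OF rS[OF x(1)] x(2)] .
  \<comment> \<open>Evaluation at \<open>x\<^sub>1\<close> identifies the real part of
    \<open>a\<close> as \<open>cos t\<close>; the same identity at any other \<open>x\<close> then
    makes the displacement constant.\<close>
  have inner_a: "rot (t/2) x \<bullet> qmul a (rot (t/2) x) = a $ 1" if "x \<in> S3" for x
    using rS[OF that] by (simp add: inner_qmul_self norm_eq_1)
  have a1: "a $ 1 = cos t" using inner_a[OF x(1)] a(2) t(3) by simp
  let ?\<sigma> = "restrict (qmul a \<circ> rot (t/2)) S3"
  have "?\<sigma> \<in> isometries hopf_randers"
    by (intro orthogonal_isometry orthogonal_transformation_compose orthogonal_qmul orthogonal_rot a)
      (simp add: qmul_hopf rot_hopf)
  moreover have "finsler_dist hopf_randers x (?\<sigma> x) = 3/2 * t" if "x \<in> S3" for x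
  proof (rule finsler_dist_hopf_randers[OF that _ t(1,2)])
    show "?\<sigma> x \<in> S3" using that a(1) by (simp add: norm_qmul)
    show "rot (t/2) x \<bullet> ?\<sigma> x = cos t" using that inner_a[OF that] a1 by simp
  qed
  ultimately have "CW_translation hopf_randers ?\<sigma>"
    unfolding CW_translation_def constant_on_def by blast
  moreover have "?\<sigma> x\<^sub>1 = x\<^sub>2" using x(1) a(2) by simp
  ultimately show "\<exists>\<sigma>. CW_translation hopf_randers \<sigma> \<and> \<sigma> x\<^sub>1 = x\<^sub>2" by blast
qed

theorem proposition4p2:
  "\<exists>F :: real^4 \<Rightarrow> real^4 \<Rightarrow> real.
     non_riemannian_randers F \<and> homogeneous F \<and> CW_homogeneous F"
  using non_riemannian_randers_hopf_randers homogeneous_hopf_randers CW_homogeneous_hopf_randers by blast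

end
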